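(* Let $d\ge 2$, $r\in(1,\infty)$, $q$ with $r^{-1}+q^{-1}=1$, and $u\in\mathbb{R}^d$ with $\|u\|_q<1$ be fixed. Let $X_1,X_2,\dots$ be iid from a distribution $P$ on $\mathbb{R}^d$ with geometric $u$-quantile $\theta^\star$, let $\Pi$ be a prior probability distribution on $\mathbb{R}^d$, and suppose: (1) $P$ admits a density $p$ that is continuous and bounded away from $0$ on a compact set $\mathbb{X}\subset\mathbb{R}^d$ containing $\theta^\star$ and having non-empty interior; (2) $p$ is bounded on every compact subset of $\mathbb{R}^d$; (3) $\Pi$ has a density $\pi$ that is continuous and bounded away from $0$ in a neighborhood of $\theta^\star$. Then for any fixed learning rate $\omega>0$ and any sequence $a_n\to\infty$, the Gibbs posterior $\Pi_n$ satisfies $$P^n\,\Pi_n\bigl(\{\theta\in\mathbb{R}^d:\|\theta-\theta^\star\|_2>a_n n^{-1/2}\}\bigr)\to 0,\qquad n\to\infty.$$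
   Context: Notation: $\|x\|_r=(\sum_{j=1}^d|x_j|^r)^{1/r}$; $\langle\cdot,\cdot\rangle$ is the usual inner product on $\mathbb{R}^d$; $Pf=\int f\,dP$; $P^n$ denotes the joint law of $X^n=(X_1,\dots,X_n)$ and also expectation under that law. Let $\Phi_r(u,t)=\|t\|_r+\langle u,t\rangle$. The geometric $u$-quantile of $P$ is $\theta^\star=\arg\min_{\xi\in\mathbb{R}^d}P\{\Phi_r(u,X-\xi)-\Phi_r(u,X)\}$. The loss is $\ell_\theta(x)=\Phi_r(u,x-\theta)=\|x-\theta\|_r+\langle u,x-\theta\rangle$, and the empirical risk is $R_n(\theta)=\frac1n\sum_{i=1}^n\ell_\theta(X_i)$. The Gibbs posterior with learning rate $\omega>0$ and prior $\Pi$ is the data-dependent probability measure $$\Pi_n(B)=\frac{\int_B e^{-\omega nR_n(\theta)}\,\Pi(d\theta)}{\int_{\mathbb{R}^d}e^{-\omega nR_n(\theta)}\,\Pi(d\theta)},\qquad B\subseteq\mathbb{R}^d\text{ Borel}.$$ *)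

theory Defs
  imports "HOL-Probability.Probability"
begin

definition lr_norm :: "real \<Rightarrow> real ^ 'n \<Rightarrow> real" where
  "lr_norm r x = (\<Sum>j\<in>UNIV. \<bar>x $ j\<bar> powr r) powr (1 / r)"

definition Phi :: "real \<Rightarrow> real ^ 'n \<Rightarrow> real ^ 'n \<Rightarrow> real" where
  "Phi r u t = lr_norm r t + u \<bullet> t"

text \<open>Subtracting \<open>Phi r u x\<close> makes the integrand bounded in \<open>x\<close> for each \<open>\<xi>\<close>
  (for \<open>r \<ge> 1\<close>), so the integral is meaningful without any moment condition on \<open>P\<close>.\<close>

definition is_geometric_quantile ::
    "real \<Rightarrow> real ^ 'n \<Rightarrow> (real ^ 'n) measure \<Rightarrow> real ^ 'n \<Rightarrow> bool" where
  "is_geometric_quantile r u P \<theta> \<longleftrightarrow>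
     is_arg_min (\<lambda>\<xi>. \<integral>x. Phi r u (x - \<xi>) - Phi r u x \<partial>P) (\<lambda>\<xi>. True) \<theta>"

definition loss :: "real \<Rightarrow> real ^ 'n \<Rightarrow> real ^ 'n \<Rightarrow> real ^ 'n \<Rightarrow> real" where
  "loss r u \<theta> x = Phi r u (x - \<theta>)"

text \<open>A sample of size \<open>n\<close> is a function whose values at \<open>1, \<dots>, n\<close> are the observations.\<close>

definition emp_risk ::
    "real \<Rightarrow> real ^ 'n \<Rightarrow> nat \<Rightarrow> (nat \<Rightarrow> real ^ 'n) \<Rightarrow> real ^ 'n \<Rightarrow> real" where
  "emp_risk r u n x \<theta> = (1 / real n) * (\<Sum>i=1..n. loss r u \<theta> (x i))"

definition gibbs_posterior ::
    "real \<Rightarrow> real ^ 'n \<Rightarrow> real \<Rightarrow> (real ^ 'n) measure \<Rightarrow> nat \<Rightarrow> (nat \<Rightarrow> real ^ 'n)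
      \<Rightarrow> (real ^ 'n) measure" where
  "gibbs_posterior r u \<omega> Q n x =
     density Q (\<lambda>\<theta>. ennreal (exp (- \<omega> * real n * emp_risk r u n x \<theta>)
                 / (\<integral>\<theta>'. exp (- \<omega> * real n * emp_risk r u n x \<theta>') \<partial>Q)))"

lemma lr_norm_nonneg: "0 \<le> lr_norm r x"
  unfolding lr_norm_def by simp

lemma lr_norm_measurable [measurable]: "lr_norm r \<in> borel_measurable borel"
  unfolding lr_norm_def [abs_def] by measurable

lemma emp_risk_measurable [measurable]: "emp_risk r u n x \<in> borel_measurable borel"
  unfolding emp_risk_def [abs_def] loss_def Phi_def by measurable

lemma
  assumes Q: "prob_space Q" "sets Q = sets borel"
    and int: "integrable Q (\<lambda>\<theta>. exp (- \<omega> * real n * emp_risk r u n x \<theta>))"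
  shows measure_gibbs_posterior: "B \<in> sets borel \<Longrightarrow>
      measure (gibbs_posterior r u \<omega> Q n x) B =
        (LINT \<theta>:B|Q. exp (- \<omega> * real n * emp_risk r u n x \<theta>))
        / (\<integral>\<theta>. exp (- \<omega> * real n * emp_risk r u n x \<theta>) \<partial>Q)"
    and prob_space_gibbs_posterior: "prob_space (gibbs_posterior r u \<omega> Q n x)"
proof -
  interpret prob_space Q by fact
  define f where "f = (\<lambda>\<theta>. exp (- \<omega> * real n * emp_risk r u n x \<theta>))"
  have [measurable_cong]: "sets Q = sets borel" by fact
  have f [measurable]: "f \<in> borel_measurable borel"
    unfolding f_def by measurable
  have int: "integrable Q f" using int by (simp add: f_def)
  have pos: "0 < f \<theta>" for \<theta> by (simp add: f_def)
  define Z where "Z = integral\<^sup>L Q f"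
  have Z: "0 < Z"
  proof -
    have "Z \<noteq> 0"
      unfolding Z_def
    proof
      assume "integral\<^sup>L Q f = 0"
      then have "AE \<theta> in Q. f \<theta> = 0"
        using integral_nonneg_eq_0_iff_AE [OF int] pos by (simp add: less_imp_le)
      then have "AE \<theta> in Q. False"
        by eventually_elim (metis pos less_irrefl)
      then show False by simp
    qed
    moreover have "0 \<le> Z"
      unfolding Z_def by (intro Bochner_Integration.integral_nonneg) (simp add: pos less_imp_le)
    ultimately show ?thesis by simp
  qed
  have G: "gibbs_posterior r u \<omega> Q n x = density Q (\<lambda>\<theta>. ennreal (f \<theta> / Z))"
    by (simp add: gibbs_posterior_def f_def Z_def)
  have *: "emeasure (gibbs_posterior r u \<omega> Q n x) B = ennreal ((LINT \<theta>:B|Q. f \<theta>) / Z)"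
    if B: "B \<in> sets borel" for B
  proof -
    have [measurable]: "B \<in> sets Q" using B Q by simp
    have i: "integrable Q (\<lambda>\<theta>. indicator B \<theta> *\<^sub>R f \<theta>)"
      using int by (rule integrable_mult_indicator [rotated]) measurable
    have "emeasure (gibbs_posterior r u \<omega> Q n x) B
        = (\<integral>\<^sup>+\<theta>. ennreal (f \<theta> / Z) * indicator B \<theta> \<partial>Q)"
      unfolding G by (subst emeasure_density) auto
    also have "\<dots> = (\<integral>\<^sup>+\<theta>. ennreal ((indicator B \<theta> *\<^sub>R f \<theta>) / Z) \<partial>Q)"
      by (intro nn_integral_cong) (auto split: split_indicator)
    also have "\<dots> = ennreal (\<integral>\<theta>. (indicator B \<theta> *\<^sub>R f \<theta>) / Z \<partial>Q)"
      using i pos Z by (intro nn_integral_eq_integral) (auto intro!: AE_I2 simp: less_imp_le)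
    also have "(\<integral>\<theta>. (indicator B \<theta> *\<^sub>R f \<theta>) / Z \<partial>Q) = (LINT \<theta>:B|Q. f \<theta>) / Z"
      by (simp add: set_lebesgue_integral_def)
    finally show ?thesis .
  qed
  show "measure (gibbs_posterior r u \<omega> Q n x) B =
        (LINT \<theta>:B|Q. exp (- \<omega> * real n * emp_risk r u n x \<theta>))
        / (\<integral>\<theta>. exp (- \<omega> * real n * emp_risk r u n x \<theta>) \<partial>Q)" if "B \<in> sets borel"
  proof -
    have "0 \<le> (LINT \<theta>:B|Q. f \<theta>) / Z"
      unfolding set_lebesgue_integral_def
      using Z pos by (intro divide_nonneg_pos Bochner_Integration.integral_nonneg) (auto simp: less_imp_le)
    then show ?thesis
      using * [OF that] by (simp add: measure_def f_def Z_def)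
  qed
  show "prob_space (gibbs_posterior r u \<omega> Q n x)"
  proof
    have "space Q = UNIV" using Q sets_eq_imp_space_eq [of Q borel] by simp
    then have "space (gibbs_posterior r u \<omega> Q n x) = UNIV"
      by (simp add: G)
    then show "emeasure (gibbs_posterior r u \<omega> Q n x) (space (gibbs_posterior r u \<omega> Q n x)) = 1"
      using * [of UNIV] Z by (simp add: set_lebesgue_integral_def Z_def)
  qed
qed

definition joint_law ::
    "'w measure \<Rightarrow> (nat \<Rightarrow> 'w \<Rightarrow> real ^ 'n) \<Rightarrow> nat \<Rightarrow> (nat \<Rightarrow> real ^ 'n) measure" where
  "joint_law M X n =
     distr M (Pi\<^sub>M {1..n} (\<lambda>_. borel)) (\<lambda>w. \<lambda>i\<in>{1..n}. X i w)"

definition has_lebesgue_density :: "(real ^ 'n) measure \<Rightarrow> (real ^ 'n \<Rightarrow> real) \<Rightarrow> bool" where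
  "has_lebesgue_density \<mu> f \<longleftrightarrow>
     f \<in> borel_measurable borel \<and> (\<forall>x. 0 \<le> f x) \<and> \<mu> = density lborel (\<lambda>x. ennreal (f x))"

definition bounded_away_from_0_on :: "'a set \<Rightarrow> ('a \<Rightarrow> real) \<Rightarrow> bool" where
  "bounded_away_from_0_on S f \<longleftrightarrow> (\<exists>c>0. \<forall>x\<in>S. c \<le> f x)"

end

theory Submission
  imports Defs "HOL-Real_Asymp.Real_Asymp"
begin

text \<open>
  Write \<open>f \<theta> = n (R\<^sub>n \<theta> - R\<^sub>n \<theta>\<^sup>\<star>)\<close>. This function is convex, and it equals the linear term
  \<open>- (\<Sum>i g (X\<^sub>i)) \<bullet> (\<theta> - \<theta>\<^sup>\<star>)\<close>, where \<open>g\<close> is a bounded subgradient of mean zero, plus a sum of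
  nonnegative remainders. By Hoeffding's inequality the linear term is of order
  \<open>\<surd>n |\<theta> - \<theta>\<^sup>\<star>|\<close>. The Hessian of the norm at \<open>t\<close> degenerates only in the direction \<open>t\<close>, so
  for two small balls seen from \<open>\<theta>\<^sup>\<star>\<close> in different directions (here \<open>d \<ge> 2\<close> enters) each
  displacement has a remainder of at least a multiple of \<open>|\<theta> - \<theta>\<^sup>\<star>|\<^sup>2\<close> on all of one of the balls,
  and both balls contain a positive fraction of the sample. Hence with high probability
  \<open>f \<ge> L\<close> on the sphere of radius \<open>L / \<surd>n\<close>, and by convexity \<open>f \<theta> \<ge> \<surd>n |\<theta> - \<theta>\<^sup>\<star>|\<close> outside it.

  No matching upper bound on \<open>f\<close> is needed. Near \<open>\<theta>\<^sup>\<star>\<close> the contraction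
  \<open>\<theta> \<mapsto> (\<theta> + \<theta>\<^sup>\<star>) / 2\<close> at least halves \<open>f\<close>, which bounds the mass of the tail by
  \<open>exp (- \<omega> a\<^sub>n / 2)\<close> times the normalising constant, up to a constant factor; away from \<open>\<theta>\<^sup>\<star>\<close> the
  bound \<open>exp (- const \<surd>n)\<close> beats the lower bound \<open>const n\<^sup>-\<^sup>d\<close> for the normalising constant
  that the Lipschitz property of the loss gives.
\<close>

subsection \<open>Hoelder duality for the r-norm\<close>

text \<open>The gradient of the norm off the coordinate hyperplanes. On them the junk values
  \<open>0 powr a = 0\<close> and \<open>sgn 0 = 0\<close> still make it a subgradient for \<open>r > 1\<close>.\<close>

definition lr_grad :: "real \<Rightarrow> real ^ 'n \<Rightarrow> real ^ 'n" where
  "lr_grad r t = (\<chi> j. sgn (t $ j) * \<bar>t $ j\<bar> powr (r - 1) * lr_norm r t powr (1 - r))"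

lemma lr_norm_powr:
  assumes "0 < r"
  shows "lr_norm r x powr r = (\<Sum>j\<in>UNIV. \<bar>x $ j\<bar> powr r)"
  using assms by (simp add: lr_norm_def powr_powr sum_nonneg)

lemma lr_norm_eq_0_iff:
  assumes "0 < r"
  shows "lr_norm r x = 0 \<longleftrightarrow> x = 0"
proof
  assume "lr_norm r x = 0"
  then have "(\<Sum>j\<in>UNIV. \<bar>x $ j\<bar> powr r) = 0"
    using lr_norm_powr[OF assms, of x] by simp
  then have "\<forall>j\<in>UNIV. \<bar>x $ j\<bar> powr r = 0"
    by (subst (asm) sum_nonneg_eq_0_iff) auto
  then show "x = 0" by (simp add: vec_eq_iff)
next
  assume "x = 0"
  then show "lr_norm r x = 0" using assms by (simp add: lr_norm_def)
qed

lemma lr_norm_scaleR: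
  assumes "0 < r"
  shows "lr_norm r (c *\<^sub>R x) = \<bar>c\<bar> * lr_norm r x"
proof -
  have "(\<Sum>j\<in>UNIV. \<bar>(c *\<^sub>R x) $ j\<bar> powr r) = \<bar>c\<bar> powr r * (\<Sum>j\<in>UNIV. \<bar>x $ j\<bar> powr r)"
    by (simp add: abs_mult powr_mult sum_distrib_left)
  then show ?thesis
    using assms by (simp add: lr_norm_def powr_mult sum_nonneg powr_powr)
qed

lemma lr_norm_minus: "lr_norm r (- x) = lr_norm r x"
  by (simp add: lr_norm_def)

lemma lr_norm_axis:
  assumes "0 < r"
  shows "lr_norm r (axis k 1) = 1"
proof -
  have "(\<Sum>j\<in>UNIV. \<bar>axis k (1::real) $ j\<bar> powr r) = (\<Sum>j\<in>UNIV. if j = k then 1 else 0)"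
    using assms by (intro sum.cong) (auto simp: axis_def)
  then show ?thesis by (simp add: lr_norm_def)
qed

text \<open>Young's inequality is applied coordinatewise after both vectors are normalised to have
  norm 1. The two normalised sums then contribute \<open>1 / q\<close> and
  \<open>1 / r\<close>.\<close>

lemma lr_norm_Holder:
  assumes "1 < r" "1 / r + 1 / q = 1"
  shows "\<bar>x \<bullet> y\<bar> \<le> lr_norm q x * lr_norm r y"
proof (cases "x = 0 \<or> y = 0")
  case True
  then show ?thesis by (auto simp: lr_norm_nonneg)
next
  case False
  have q: "1 < q"
  proof -
    have "1 / q = 1 - 1 / r" "0 < 1 / r" "1 / r < 1" using assms by auto
    then have "0 < 1 / q" "1 / q < 1" by linarith+
    then show ?thesis by (simp add: divide_simps split: if_splits)
  qed
  define a where "a = lr_norm q x"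
  define b where "b = lr_norm r y"
  have a: "0 < a" and b: "0 < b"
    using False lr_norm_eq_0_iff[of q x] lr_norm_eq_0_iff[of r y] assms q lr_norm_nonneg[of q x] lr_norm_nonneg[of r y]
    unfolding a_def b_def by auto
  have "\<bar>x \<bullet> y\<bar> \<le> (\<Sum>j\<in>UNIV. \<bar>x $ j\<bar> * \<bar>y $ j\<bar>)"
    unfolding inner_vec_def by (rule order_trans[OF sum_abs]) (simp add: abs_mult)
  also have "\<dots> = a * b * (\<Sum>j\<in>UNIV. (\<bar>x $ j\<bar> / a) * (\<bar>y $ j\<bar> / b))"
    using a b by (simp add: sum_distrib_left)
  also have "\<dots> \<le> a * b * (\<Sum>j\<in>UNIV. (\<bar>x $ j\<bar> / a) powr q / q + (\<bar>y $ j\<bar> / b) powr r / r)"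
    using a b assms q by (intro mult_left_mono sum_mono Youngs_inequality) auto
  also have "(\<Sum>j\<in>UNIV. (\<bar>x $ j\<bar> / a) powr q / q + (\<bar>y $ j\<bar> / b) powr r / r)
      = (\<Sum>j\<in>UNIV. \<bar>x $ j\<bar> powr q) / (a powr q) / q + (\<Sum>j\<in>UNIV. \<bar>y $ j\<bar> powr r) / (b powr r) / r"
    using a b by (simp add: sum.distrib powr_divide sum_divide_distrib)
  also have "\<dots> = 1 / q + 1 / r"
    using lr_norm_powr[of q x, folded a_def, symmetric] lr_norm_powr[of r y, folded b_def, symmetric] q assms a b
    by simp
  also have "1 / q + 1 / r = 1" using assms by simp
  finally show ?thesis by (simp add: a_def b_def)
qed

lemma lr_grad_inner_self:
  assumes "1 < r"
  shows "lr_grad r t \<bullet> t = lr_norm r t"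
proof (cases "t = 0")
  case True
  then show ?thesis using assms lr_norm_eq_0_iff[of r t] by simp
next
  case False
  then have N: "0 < lr_norm r t"
    using assms lr_norm_eq_0_iff[of r t] lr_norm_nonneg[of r t] by auto
  have "sgn z * \<bar>z\<bar> powr (r - 1) * z = \<bar>z\<bar> powr r" for z :: real
    using powr_mult_base[of "\<bar>z\<bar>" "r - 1"] by (cases z "0::real" rule: linorder_cases) (auto simp: mult.commute)
  then have *: "sgn z * \<bar>z\<bar> powr (r - 1) * c * z = \<bar>z\<bar> powr r * c" for z c :: real
    by (metis (no_types, lifting) mult.assoc mult.commute)
  have "lr_grad r t \<bullet> t = (\<Sum>j\<in>UNIV. \<bar>t $ j\<bar> powr r) * lr_norm r t powr (1 - r)"
    unfolding sum_distrib_right inner_vec_def lr_grad_def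
    by (intro sum.cong refl) (simp only: vec_lambda_beta inner_real_def *)
  also have "\<dots> = lr_norm r t"
    using assms N by (simp add: lr_norm_powr[symmetric] powr_add[symmetric])
  finally show ?thesis .
qed

text \<open>The gradient has dual norm 1 for \<open>t \<noteq> 0\<close>, and it is 0 for
  \<open>t = 0\<close>; the bound is then Hoelder's inequality with the conjugate exponent
  \<open>r / (r - 1)\<close>.\<close>

lemma lr_grad_inner_le:
  assumes "1 < r"
  shows "\<bar>lr_grad r t \<bullet> s\<bar> \<le> lr_norm r s"
proof -
  define q where "q = r / (r - 1)"
  have rq: "1 / r + 1 / q = 1" and q: "0 < q" using assms by (auto simp: q_def field_simps)
  have rq': "(r - 1) * q = r" "(1 - r) * q = - r" using assms by (auto simp: q_def field_simps)
  have "lr_norm q (lr_grad r t) \<le> 1"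
  proof (cases "t = 0")
    case True
    then have "lr_grad r t = 0" by (simp add: lr_grad_def vec_eq_iff)
    then show ?thesis using lr_norm_eq_0_iff[OF q, of "lr_grad r t"] by simp
  next
    case False
    then have N: "0 < lr_norm r t"
      using assms lr_norm_eq_0_iff[of r t] lr_norm_nonneg[of r t] by auto
    have "\<bar>lr_grad r t $ j\<bar> powr q = \<bar>t $ j\<bar> powr r * lr_norm r t powr (- r)" for j
    proof (cases "t $ j = 0")
      case True
      then show ?thesis using q by (simp add: lr_grad_def)
    next
      case False
      then show ?thesis by (simp add: lr_grad_def abs_mult powr_mult powr_powr rq')
    qed
    then have "(\<Sum>j\<in>UNIV. \<bar>lr_grad r t $ j\<bar> powr q) = lr_norm r t powr r * lr_norm r t powr (- r)"
      using assms by (simp add: lr_norm_powr sum_distrib_right)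
    also have "\<dots> = 1" using N by (simp add: powr_add[symmetric])
    finally show ?thesis by (simp add: lr_norm_def)
  qed
  then have "lr_norm q (lr_grad r t) * lr_norm r s \<le> 1 * lr_norm r s"
    by (intro mult_right_mono lr_norm_nonneg)
  then show ?thesis using lr_norm_Holder[OF assms rq, of "lr_grad r t" s] by simp
qed

text \<open>No differentiation is involved: \<open>lr_grad r t\<close> has inner product
  \<open>lr_norm r t\<close> with \<open>t\<close> and at most \<open>lr_norm r (t + d)\<close> with
  \<open>t + d\<close>. Hence the inequality also holds on the coordinate hyperplanes.\<close>

lemma lr_norm_subgradient:
  assumes "1 < r"
  shows "lr_norm r t + lr_grad r t \<bullet> d \<le> lr_norm r (t + d)"
  using lr_grad_inner_le[OF assms, of t "t + d"] lr_grad_inner_self[OF assms, of t]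
  by (simp add: inner_add_right)

lemma abs_lr_grad_le_1:
  assumes "1 < r"
  shows "\<bar>lr_grad r t $ j\<bar> \<le> 1"
  using lr_grad_inner_le[OF assms, of t "axis j 1"] assms lr_norm_axis[of r j]
  by (simp add: inner_axis)

text \<open>Minkowski's inequality by duality: the gradient at \<open>s + t\<close> attains the norm
  of \<open>s + t\<close> and is bounded by the norm on each summand.\<close>

lemma lr_norm_triangle:
  assumes "1 < r"
  shows "lr_norm r (s + t) \<le> lr_norm r s + lr_norm r t"
proof -
  have "lr_norm r (s + t) = lr_grad r (s + t) \<bullet> s + lr_grad r (s + t) \<bullet> t"
    using lr_grad_inner_self[OF assms, of "s + t"] by (simp add: inner_add_right)
  also have "\<dots> \<le> lr_norm r s + lr_norm r t"
    using lr_grad_inner_le[OF assms, of "s + t" s] lr_grad_inner_le[OF assms, of "s + t" t] by linarith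
  finally show ?thesis .
qed

lemma lr_norm_le_norm:
  fixes t :: "real ^ 'n"
  assumes "1 < r"
  shows "lr_norm r t \<le> CARD('n) * norm t"
proof -
  have "lr_norm r t = (\<Sum>j\<in>UNIV. lr_grad r t $ j * t $ j)"
    using lr_grad_inner_self[OF assms, of t] by (simp add: inner_vec_def)
  also have "\<dots> \<le> (\<Sum>j\<in>(UNIV::'n set). norm t)"
  proof (rule sum_mono)
    fix j
    have "lr_grad r t $ j * t $ j \<le> \<bar>lr_grad r t $ j\<bar> * \<bar>t $ j\<bar>"
      by (metis abs_ge_self abs_mult)
    also have "\<dots> \<le> 1 * norm t"
      using abs_lr_grad_le_1[OF assms] component_le_norm_cart by (intro mult_mono) auto
    finally show "lr_grad r t $ j * t $ j \<le> norm t" by simp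
  qed
  finally show ?thesis by simp
qed

lemma lr_grad_measurable [measurable]: "lr_grad r \<in> borel_measurable borel"
proof -
  have "(\<lambda>t. lr_grad r t $ j) \<in> borel_measurable borel" for j
    unfolding lr_grad_def by simp
  then show ?thesis
    by (subst borel_measurable_euclidean_space) (auto simp: Basis_vec_def inner_axis)
qed

subsection \<open>Strict convexity of the r-norm off the coordinate hyperplanes\<close>

lemma eventually_sgn_eq:
  fixes f :: "real \<Rightarrow> real"
  assumes "isCont f s" "f s \<noteq> 0"
  shows "\<forall>\<^sub>F t in nhds s. sgn (f t) = sgn (f s)"
proof (cases "0 < f s")
  case True
  have "\<forall>\<^sub>F t in nhds s. 0 < f t"
    using assms(1) True unfolding isCont_def tendsto_at_iff_tendsto_nhds by (rule order_tendstoD)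
  then show ?thesis by eventually_elim (use True in simp)
next
  case False
  then have "f s < 0" using assms(2) by simp
  then have "\<forall>\<^sub>F t in nhds s. f t < 0"
    using assms(1) unfolding isCont_def tendsto_at_iff_tendsto_nhds by (intro order_tendstoD)
  then show ?thesis by eventually_elim (use \<open>f s < 0\<close> in simp)
qed

lemma has_real_derivative_abs_powr:
  fixes r d :: real
  assumes "(f has_real_derivative d) (at s)" "f s \<noteq> 0"
  shows "((\<lambda>s. \<bar>f s\<bar> powr r) has_real_derivative r * (sgn (f s) * \<bar>f s\<bar> powr (r - 1) * d)) (at s)"
proof -
  have "\<forall>\<^sub>F t in nhds s. \<bar>f t\<bar> = sgn (f s) * f t"
    using eventually_sgn_eq[OF DERIV_isCont[OF assms(1)] assms(2)]
    by eventually_elim (metis abs_sgn mult.commute)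
  moreover have "((\<lambda>t. sgn (f s) * f t) has_real_derivative sgn (f s) * d) (at s)"
    by (intro DERIV_cmult assms)
  ultimately have "((\<lambda>s. \<bar>f s\<bar>) has_real_derivative sgn (f s) * d) (at s)"
    by (simp add: DERIV_cong_ev)
  from DERIV_chain2[OF has_real_derivative_powr this, of r] assms(2)
  show ?thesis by (simp add: mult_ac)
qed

lemma has_real_derivative_sgn_abs_powr:
  fixes r d :: real
  assumes "(f has_real_derivative d) (at s)" "f s \<noteq> 0"
  shows "((\<lambda>s. sgn (f s) * \<bar>f s\<bar> powr r) has_real_derivative r * (\<bar>f s\<bar> powr (r - 1) * d)) (at s)"
proof -
  have ev: "\<forall>\<^sub>F t in nhds s. sgn (f t) * \<bar>f t\<bar> powr r = sgn (f s) * \<bar>f t\<bar> powr r"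
    using eventually_sgn_eq[OF DERIV_isCont[OF assms(1)] assms(2)] by eventually_elim simp
  have "((\<lambda>t. sgn (f s) * \<bar>f t\<bar> powr r) has_real_derivative
      sgn (f s) * (r * (sgn (f s) * \<bar>f s\<bar> powr (r - 1) * d))) (at s)"
    by (intro DERIV_cmult has_real_derivative_abs_powr assms)
  moreover have "sgn (f s) * (r * (sgn (f s) * \<bar>f s\<bar> powr (r - 1) * d)) = r * (\<bar>f s\<bar> powr (r - 1) * d)"
    using assms(2) by (cases "f s > 0") (auto simp: sgn_if)
  ultimately show ?thesis
    using DERIV_cong_ev[OF refl ev refl] by simp
qed

text \<open>By the Lagrange identity this equals twice the Gram determinant of \<open>t\<close> and
  \<open>d\<close>, so it measures how far the two vectors are from being parallel. The sum runs
  over ordered pairs.\<close>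

definition cross_sq :: "real ^ 'n \<Rightarrow> real ^ 'n \<Rightarrow> real" where
  "cross_sq t d = (\<Sum>j\<in>UNIV. \<Sum>k\<in>UNIV. (t $ j * d $ k - t $ k * d $ j)\<^sup>2)"

text \<open>Expanding the square gives two equal square terms, up to exchanging the indices, and a
  cross term that factorises. The weights will be \<open>\<bar>y $ j\<bar> powr (r - 2)\<close>,
  which come from differentiating the norm twice.\<close>

lemma weighted_Lagrange_identity:
  fixes w y d :: "'i \<Rightarrow> real"
  shows "2 * ((\<Sum>j\<in>A. w j * (y j)\<^sup>2) * (\<Sum>j\<in>A. w j * (d j)\<^sup>2) - (\<Sum>j\<in>A. w j * y j * d j)\<^sup>2)
    = (\<Sum>j\<in>A. \<Sum>k\<in>A. w j * w k * (y j * d k - y k * d j)\<^sup>2)"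
proof -
  have "(\<Sum>j\<in>A. \<Sum>k\<in>A. w j * w k * (y j * d k - y k * d j)\<^sup>2)
    = (\<Sum>j\<in>A. \<Sum>k\<in>A. (w j * (y j)\<^sup>2) * (w k * (d k)\<^sup>2)) + (\<Sum>j\<in>A. \<Sum>k\<in>A. (w k * (y k)\<^sup>2) * (w j * (d j)\<^sup>2))
      - 2 * (\<Sum>j\<in>A. \<Sum>k\<in>A. (w j * y j * d j) * (w k * y k * d k))"
    by (simp add: sum.distrib[symmetric] sum_subtractf[symmetric] sum_distrib_left)
      (intro sum.cong refl, simp add: power2_eq_square algebra_simps)
  also have "(\<Sum>j\<in>A. \<Sum>k\<in>A. (w k * (y k)\<^sup>2) * (w j * (d j)\<^sup>2)) = (\<Sum>j\<in>A. \<Sum>k\<in>A. (w j * (y j)\<^sup>2) * (w k * (d k)\<^sup>2))"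
    by (rule sum.swap)
  finally show ?thesis
    by (simp add: sum_product power2_eq_square)
qed

text \<open>The second derivative is a defect in the Cauchy--Schwarz inequality; by the Lagrange identity
  it only involves the minors \<open>t\<^sub>j d\<^sub>k - t\<^sub>k d\<^sub>j\<close>, which do not change along the line.\<close>

lemma lr_norm_line_derivs:
  fixes t d :: "real ^ 'n"
  assumes r: "1 < r" and nz: "\<And>j. (t + s *\<^sub>R d) $ j \<noteq> 0"
  defines "y \<equiv> t + s *\<^sub>R d"
  shows "((\<lambda>s. lr_norm r (t + s *\<^sub>R d)) has_real_derivative lr_grad r y \<bullet> d) (at s)"
    and "((\<lambda>s. lr_grad r (t + s *\<^sub>R d) \<bullet> d) has_real_derivative
      (r - 1) / 2 * lr_norm r y powr (1 - 2 * r) *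
        (\<Sum>j\<in>UNIV. \<Sum>k\<in>UNIV. \<bar>y $ j\<bar> powr (r - 2) * \<bar>y $ k\<bar> powr (r - 2) * (t $ j * d $ k - t $ k * d $ j)\<^sup>2)) (at s)"
proof -
  define Y where "Y = (\<lambda>s. t + s *\<^sub>R d)"
  \<comment> \<open>Along the line the norm is \<open>S powr (1 / r)\<close>, with
    \<open>S' = r * T\<close> and \<open>T' = (r - 1) * U\<close>. Both claims are chain and product
    rules in these three quantities.\<close>
  define S where "S = (\<lambda>s. \<Sum>j\<in>UNIV. \<bar>Y s $ j\<bar> powr r)"
  define T where "T = (\<lambda>s. \<Sum>j\<in>UNIV. sgn (Y s $ j) * \<bar>Y s $ j\<bar> powr (r - 1) * d $ j)"
  define U where "U = (\<Sum>j\<in>UNIV. \<bar>y $ j\<bar> powr (r - 2) * (d $ j)\<^sup>2)"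
  have y: "y = Y s" by (simp add: y_def Y_def)
  have nz: "Y s $ j \<noteq> 0" for j using nz by (simp add: Y_def)
  have N_S: "lr_norm r (Y s) = S s powr (1 / r)" for s
    by (simp add: lr_norm_def S_def)
  have S_nonneg: "0 \<le> S s" for s by (simp add: S_def sum_nonneg)
  have G_T: "lr_grad r (Y s) \<bullet> d = S s powr (1 / r - 1) * T s" for s
  proof -
    have "lr_norm r (Y s) powr (1 - r) = S s powr (1 / r - 1)"
      using r by (simp add: N_S powr_powr field_simps)
    then show ?thesis
      by (simp add: lr_grad_def inner_vec_def T_def sum_distrib_left mult_ac)
  qed
  have S_pos: "0 < S s"
    unfolding S_def by (rule sum_pos) (use nz in auto)
  have dY: "((\<lambda>s. Y s $ j) has_real_derivative d $ j) (at s)" for j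
    unfolding Y_def by (auto intro!: derivative_eq_intros)
  have dS: "(S has_real_derivative r * T s) (at s)"
    unfolding S_def T_def sum_distrib_left
    by (intro DERIV_sum has_real_derivative_abs_powr dY nz)
  have dT: "(T has_real_derivative (r - 1) * U) (at s)"
    unfolding T_def
  proof (rule DERIV_cong[OF DERIV_sum])
    fix j
    show "((\<lambda>s. sgn (Y s $ j) * \<bar>Y s $ j\<bar> powr (r - 1) * d $ j) has_real_derivative
        ((r - 1) * (\<bar>Y s $ j\<bar> powr (r - 1 - 1) * d $ j)) * d $ j) (at s)"
      by (intro DERIV_cmult_right has_real_derivative_sgn_abs_powr dY nz)
  next
    show "(\<Sum>j\<in>UNIV. ((r - 1) * (\<bar>Y s $ j\<bar> powr (r - 1 - 1) * d $ j)) * d $ j) = (r - 1) * U"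
      by (simp add: U_def y sum_distrib_left power2_eq_square mult_ac)
  qed
  have d1: "((\<lambda>s. S s powr \<alpha>) has_real_derivative \<alpha> * S s powr (\<alpha> - 1) * (r * T s)) (at s)" for \<alpha>
    by (rule DERIV_chain2[OF has_real_derivative_powr dS]) (rule S_pos)
  show "((\<lambda>s. lr_norm r (t + s *\<^sub>R d)) has_real_derivative lr_grad r y \<bullet> d) (at s)"
    using d1[of "1 / r"] r by (simp only: y G_T Y_def[symmetric, THEN fun_cong] N_S) simp
  have deriv: "((\<lambda>s. S s powr (1 / r - 1) * T s) has_real_derivative
      (1 / r - 1) * S s powr (1 / r - 1 - 1) * (r * T s) * T s + (r - 1) * U * S s powr (1 / r - 1)) (at s)"
    by (rule DERIV_mult'[OF d1 dT, THEN DERIV_cong]) simp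
  \<comment> \<open>Both terms of the product rule carry the factor
    \<open>S s powr (1 / r - 2)\<close>; what remains is the Cauchy-Schwarz defect of
    \<open>S\<close>, \<open>T\<close> and \<open>U\<close>.\<close>
  have collect: "(1 / r - 1) * S s powr (1 / r - 1 - 1) * (r * T s) * T s + (r - 1) * U * S s powr (1 / r - 1)
      = (r - 1) * S s powr (1 / r - 2) * (S s * U - (T s)\<^sup>2)"
  proof -
    have "S s powr (1 / r - 1) = S s powr (1 / r - 2) * S s"
      using S_pos powr_mult_base[of "S s" "1 / r - 2"] by (simp add: mult.commute)
    moreover have "(1 / r - 1) * S s powr (1 / r - 1 - 1) * (r * T s) * T s
        = ((1 / r - 1) * r) * S s powr (1 / r - 2) * (T s)\<^sup>2"
      by (simp add: power2_eq_square mult_ac)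
    moreover have "(1 / r - 1) * r = - (r - 1)" using r by (simp add: field_simps)
    ultimately show ?thesis by (simp only:) (simp add: algebra_simps)
  qed
  have S_powr: "S s powr (1 / r - 2) = lr_norm r y powr (1 - 2 * r)"
    using r by (simp add: N_S y powr_powr field_simps)
  have Lagrange: "S s * U - (T s)\<^sup>2
    = 1 / 2 * (\<Sum>j\<in>UNIV. \<Sum>k\<in>UNIV. \<bar>y $ j\<bar> powr (r - 2) * \<bar>y $ k\<bar> powr (r - 2) * (t $ j * d $ k - t $ k * d $ j)\<^sup>2)"
  proof -
    have "S s = (\<Sum>j\<in>UNIV. \<bar>y $ j\<bar> powr (r - 2) * (y $ j)\<^sup>2)"
      unfolding S_def y
    proof (intro sum.cong refl)
      fix j
      have "\<bar>Y s $ j\<bar> powr r = \<bar>Y s $ j\<bar> powr (r - 2) * \<bar>Y s $ j\<bar> powr 2"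
        using powr_add[of "\<bar>Y s $ j\<bar>" "r - 2" 2] by simp
      also have "\<bar>Y s $ j\<bar> powr 2 = (Y s $ j)\<^sup>2"
        using powr_realpow[of "\<bar>Y s $ j\<bar>" 2] nz[of j] by simp
      finally show "\<bar>Y s $ j\<bar> powr r = \<bar>Y s $ j\<bar> powr (r - 2) * (Y s $ j)\<^sup>2" .
    qed
    moreover have "T s = (\<Sum>j\<in>UNIV. \<bar>y $ j\<bar> powr (r - 2) * y $ j * d $ j)"
      unfolding T_def y
    proof (intro sum.cong refl)
      fix j
      have "\<bar>Y s $ j\<bar> powr (r - 1) = \<bar>Y s $ j\<bar> powr (r - 2) * \<bar>Y s $ j\<bar>"
        using powr_mult_base[of "\<bar>Y s $ j\<bar>" "r - 2"] by (simp add: mult.commute)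
      then show "sgn (Y s $ j) * \<bar>Y s $ j\<bar> powr (r - 1) * d $ j = \<bar>Y s $ j\<bar> powr (r - 2) * Y s $ j * d $ j"
        using sgn_mult_abs[of "Y s $ j"] by (simp add: mult_ac)
    qed
    moreover have "t $ j * d $ k - t $ k * d $ j = y $ j * d $ k - y $ k * d $ j" for j k
      by (simp add: y_def algebra_simps)
    ultimately show ?thesis
      unfolding U_def by (simp only: weighted_Lagrange_identity[symmetric]) simp
  qed
  show "((\<lambda>s. lr_grad r (t + s *\<^sub>R d) \<bullet> d) has_real_derivative
      (r - 1) / 2 * lr_norm r y powr (1 - 2 * r) *
        (\<Sum>j\<in>UNIV. \<Sum>k\<in>UNIV. \<bar>y $ j\<bar> powr (r - 2) * \<bar>y $ k\<bar> powr (r - 2) * (t $ j * d $ k - t $ k * d $ j)\<^sup>2)) (at s)"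
    using deriv unfolding collect S_powr Lagrange
    by (simp add: G_T[symmetric] Y_def)
qed

lemma lr_norm_pos_if_component:
  assumes "0 < r" "t $ j \<noteq> 0"
  shows "0 < lr_norm r t"
  using assms lr_norm_eq_0_iff[of r t] lr_norm_nonneg[of r t] by force

lemma open_nonzero_components: "open {t :: real ^ 'n. \<forall>j. t $ j \<noteq> 0}"
proof -
  have "{t :: real ^ 'n. \<forall>j. t $ j \<noteq> 0} = (\<Inter>j. {t. t $ j \<noteq> 0})" by auto
  also have "open \<dots>"
    by (intro open_INT) (auto intro!: open_Collect_neq continuous_intros)
  finally show ?thesis .
qed

lemma continuous_on_lr_norm: "1 < r \<Longrightarrow> continuous_on A (lr_norm r)"
  unfolding lr_norm_def [abs_def] 
  by (intro continuous_on_powr' continuous_intros) (auto intro!: sum_nonneg simp: sum_nonneg_eq_0_iff) 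

text \<open>The weights of the second derivative vanish or blow up at the coordinate hyperplanes
  when \<open>r \<noteq> 2\<close>. On a compact set avoiding these they are continuous and
  positive, so each pair of indices has a positive minimum, and there are finitely many
  pairs.\<close>

lemma weights_bounded_below:
  fixes C :: "(real ^ 'n) set"
  assumes r: "1 < r" and C: "compact C" and nz: "\<And>y j. y \<in> C \<Longrightarrow> y $ j \<noteq> 0"
  obtains c where "0 < c"
    "\<And>y j k. y \<in> C \<Longrightarrow> c \<le> lr_norm r y powr (1 - 2 * r) * (\<bar>y $ j\<bar> powr (r - 2) * \<bar>y $ k\<bar> powr (r - 2))"
proof -
  define h where "h = (\<lambda>(j, k) (y :: real ^ 'n). lr_norm r y powr (1 - 2 * r) * (\<bar>y $ j\<bar> powr (r - 2) * \<bar>y $ k\<bar> powr (r - 2)))"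
  have "\<exists>c>0. \<forall>y\<in>C. c \<le> h p y" for p
  proof (cases "C = {}")
    case True
    then show ?thesis by (auto intro: exI[of _ 1])
  next
    case False
    have pos: "0 < h p y" if "y \<in> C" for y
      using nz[OF that] lr_norm_pos_if_component[of r y] r by (cases p) (auto simp: h_def)
    have "continuous_on C (h p)"
      using nz lr_norm_pos_if_component[of r] r
      by (cases p) (auto simp: h_def intro!: continuous_intros continuous_on_lr_norm, force+)
    then obtain y where "y \<in> C" "\<And>z. z \<in> C \<Longrightarrow> h p y \<le> h p z"
      using continuous_attains_inf[OF C False] by blast
    then show ?thesis using pos by auto
  qed
  then obtain c where c: "\<And>p. 0 < c p" "\<And>p y. y \<in> C \<Longrightarrow> c p \<le> h p y" by metis
  define m where "m = Min (range c)"
  have "0 < m" unfolding m_def using c by (subst Min_gr_iff) auto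
  moreover have "m \<le> h p y" if "y \<in> C" for p y
    unfolding m_def by (rule order_trans[OF Min_le c(2)[OF that]]) auto
  ultimately show ?thesis using that[of m] unfolding h_def by fastforce
qed

text \<open>Second-order Taylor expansion along the segment from \<open>t\<close> to
  \<open>t + d\<close>, which convexity keeps inside \<open>C\<close>. The minors are constant on
  the segment, so bounding the weights bounds the whole remainder.\<close>

lemma lr_norm_strict_subgradient:
  fixes C :: "(real ^ 'n) set"
  assumes r: "1 < r" and C: "compact C" "convex C" and nz: "\<And>y j. y \<in> C \<Longrightarrow> y $ j \<noteq> 0"
  obtains c where "0 < c" "\<And>t d. t \<in> C \<Longrightarrow> t + d \<in> C \<Longrightarrow>
    lr_norm r t + lr_grad r t \<bullet> d + c * cross_sq t d \<le> lr_norm r (t + d)"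
proof -
  obtain m where m: "0 < m"
    "\<And>y j k. y \<in> C \<Longrightarrow> m \<le> lr_norm r y powr (1 - 2 * r) * (\<bar>y $ j\<bar> powr (r - 2) * \<bar>y $ k\<bar> powr (r - 2))"
    using weights_bounded_below[OF r C(1) nz] by blast
  have "lr_norm r t + lr_grad r t \<bullet> d + (r - 1) / 4 * m * cross_sq t d \<le> lr_norm r (t + d)"
    if t: "t \<in> C" "t + d \<in> C" for t d
  proof -
    define D where "D = (\<lambda>s. (r - 1) / 2 * lr_norm r (t + s *\<^sub>R d) powr (1 - 2 * r) *
        (\<Sum>j\<in>UNIV. \<Sum>k\<in>UNIV. \<bar>(t + s *\<^sub>R d) $ j\<bar> powr (r - 2) * \<bar>(t + s *\<^sub>R d) $ k\<bar> powr (r - 2) * (t $ j * d $ k - t $ k * d $ j)\<^sup>2))"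
    have line: "t + s *\<^sub>R d \<in> C" if "0 \<le> s" "s \<le> 1" for s
      using convexD_alt[OF C(2) t that] by (simp add: algebra_simps)
    have D_ge: "(r - 1) / 2 * m * cross_sq t d \<le> D s" if "0 \<le> s" "s \<le> 1" for s
    proof -
      have "D s = (r - 1) / 2 * (\<Sum>j\<in>UNIV. \<Sum>k\<in>UNIV. (lr_norm r (t + s *\<^sub>R d) powr (1 - 2 * r) *
        (\<bar>(t + s *\<^sub>R d) $ j\<bar> powr (r - 2) * \<bar>(t + s *\<^sub>R d) $ k\<bar> powr (r - 2))) * (t $ j * d $ k - t $ k * d $ j)\<^sup>2)"
        unfolding D_def sum_distrib_left by (simp add: mult_ac)
      also have "\<dots> \<ge> (r - 1) / 2 * (\<Sum>j\<in>UNIV. \<Sum>k\<in>UNIV. m * (t $ j * d $ k - t $ k * d $ j)\<^sup>2)"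
        using r by (intro mult_left_mono sum_mono mult_right_mono m(2) line that) auto
      finally show ?thesis by (simp only: cross_sq_def sum_distrib_left mult.assoc)
    qed
    \<comment> \<open>\<open>Taylor_up\<close> of order 2 requires the derivative relation only for
      indices below 2. Its factor \<open>1 / fact 2\<close> turns the \<open>(r - 1) / 2\<close> in
      \<open>D\<close> into the claimed \<open>(r - 1) / 4\<close>.\<close>
    define diff where "diff = (\<lambda>m::nat. if m = 0 then (\<lambda>s. lr_norm r (t + s *\<^sub>R d))
      else if m = 1 then (\<lambda>s. lr_grad r (t + s *\<^sub>R d) \<bullet> d) else D)"
    have "\<exists>\<tau>>0. \<tau> < 1 \<and> lr_norm r (t + 1 *\<^sub>R d) = (\<Sum>m<2. diff m 0 / fact m * (1 - 0) ^ m) + diff 2 \<tau> / fact 2 * (1 - 0) ^ 2"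
    proof (rule Taylor_up)
      show "\<forall>m s. m < 2 \<and> 0 \<le> s \<and> s \<le> 1 \<longrightarrow> (diff m has_real_derivative diff (Suc m) s) (at s)"
        using lr_norm_line_derivs[OF r nz[OF line], of _ ] unfolding diff_def D_def
        by (auto simp: less_2_cases_iff)
    qed (auto simp: diff_def)
    then obtain \<tau> where \<tau>: "0 < \<tau>" "\<tau> < 1"
      "lr_norm r (t + d) = lr_norm r t + lr_grad r t \<bullet> d + D \<tau> / 2"
      by (auto simp: diff_def numeral_2_eq_2)
    then show ?thesis using D_ge[of \<tau>] by (simp add: algebra_simps)
  qed
  then show ?thesis using that[of "(r - 1) / 4 * m"] r m(1) by simp
qed

section \<open>Uniform lower bounds on the minors over two small balls\<close>

lemma cross_sq_scaleR: "cross_sq t (s *\<^sub>R d) = s\<^sup>2 * cross_sq t d"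
proof -
  have "(t $ j * (s *\<^sub>R d) $ k - t $ k * (s *\<^sub>R d) $ j)\<^sup>2 = s\<^sup>2 * (t $ j * d $ k - t $ k * d $ j)\<^sup>2" for j k
    by (simp add: power2_eq_square algebra_simps)
  then show ?thesis by (simp add: cross_sq_def sum_distrib_left)
qed

lemma cross_sq_nonneg: "0 \<le> cross_sq t d"
  unfolding cross_sq_def by (intro sum_nonneg) simp

lemma cross_sq_eq_0D:
  assumes "cross_sq t d = 0"
  shows "t $ j * d $ k = t $ k * d $ j"
proof -
  have "(\<Sum>k\<in>UNIV. (t $ j * d $ k - t $ k * d $ j)\<^sup>2) = 0"
    using assms unfolding cross_sq_def
    by (subst (asm) sum_nonneg_eq_0_iff) (auto intro: sum_nonneg)
  then have "(t $ j * d $ k - t $ k * d $ j)\<^sup>2 = 0"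
    by (subst (asm) sum_nonneg_eq_0_iff) auto
  then show ?thesis by simp
qed

text \<open>If both summands vanished, \<open>t1\<close> and \<open>t2\<close> would be multiples of
  \<open>d\<close>, and every minor of \<open>t1\<close> and \<open>t2\<close> would be 0.\<close>

lemma cross_sq_add_pos:
  assumes "t1 $ j * t2 $ k \<noteq> t1 $ k * t2 $ j" "d \<noteq> 0"
  shows "0 < cross_sq t1 d + cross_sq t2 d"
proof (rule ccontr)
  assume "\<not> ?thesis"
  then have 1: "cross_sq t1 d = 0" and 2: "cross_sq t2 d = 0"
    using cross_sq_nonneg[of t1 d] cross_sq_nonneg[of t2 d] by linarith+
  obtain i where i: "d $ i \<noteq> 0" using assms(2) by (auto simp: vec_eq_iff)
  have "t1 $ l = t1 $ i / d $ i * d $ l" "t2 $ l = t2 $ i / d $ i * d $ l" for l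
    using i cross_sq_eq_0D[OF 1, of l i] cross_sq_eq_0D[OF 2, of l i] by (simp_all add: field_simps)
  then have "t1 $ j * t2 $ k = (t1 $ i / d $ i * d $ j) * (t2 $ i / d $ i * d $ k)"
    "t1 $ k * t2 $ j = (t1 $ i / d $ i * d $ k) * (t2 $ i / d $ i * d $ j)"
    by metis+
  with assms(1) show False by simp
qed

text \<open>A nonempty open set is not negligible, so it is not covered by the coordinate
  hyperplanes together with one further hyperplane, on which a fixed minor with \<open>y1\<close>
  vanishes. Dimension at least 2 supplies the two indices of that minor.\<close>

lemma obtain_nonparallel_points:
  fixes W :: "(real ^ 'n) set"
  assumes "CARD('n) \<ge> 2" "open W" "W \<noteq> {}"
  obtains y1 y2 j k where "y1 \<in> W" "y2 \<in> W" "\<And>i. y1 $ i \<noteq> 0" "\<And>i. y2 $ i \<noteq> 0"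
    "y1 $ j * y2 $ k \<noteq> y1 $ k * y2 $ j"
proof -
  obtain j k :: 'n where jk: "j \<noteq> k"
    using assms(1) card_le_Suc0_iff_eq[of "UNIV :: 'n set"] by auto
  have neg: "negligible {t :: real ^ 'n. \<exists>i. t $ i = 0}"
  proof -
    have "{t :: real ^ 'n. \<exists>i. t $ i = 0} = (\<Union>i. {t. t $ i = 0})" by auto
    also have "negligible \<dots>"
      by (intro negligible_Union) (auto simp: negligible_standard_hyperplane_cart)
    finally show ?thesis .
  qed
  have nonneg: "\<not> negligible W"
    using assms(2,3) open_not_negligible by blast
  obtain y1 where y1: "y1 \<in> W" "\<And>i. y1 $ i \<noteq> 0"
  proof -
    have "\<not> W \<subseteq> {t. \<exists>i. t $ i = 0}" using nonneg negligible_subset[OF neg] by metis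
    then show ?thesis using that by auto
  qed
  \<comment> \<open>The inner product with \<open>v\<close> is the \<open>(j, k)\<close> minor of
    \<open>y1\<close> with the other vector. Its component at \<open>k\<close> is
    \<open>y1 $ j\<close>, so the hyperplane it defines is proper.\<close>
  define v :: "real ^ 'n" where "v = y1 $ j *\<^sub>R axis k 1 - y1 $ k *\<^sub>R axis j 1"
  have v: "v \<bullet> t = y1 $ j * t $ k - y1 $ k * t $ j" for t
    by (simp add: v_def inner_diff_left inner_axis' )
  have "v $ k \<noteq> 0" using jk y1 by (simp add: v_def axis_def)
  then have "v \<noteq> 0" by auto
  then have "negligible {t. v \<bullet> t = 0}" by (intro negligible_hyperplane) auto
  with neg have neg2: "negligible ({t. \<exists>i. t $ i = 0} \<union> {t. v \<bullet> t = 0})" by (rule negligible_Un)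
  obtain y2 where "y2 \<in> W" "\<And>i. y2 $ i \<noteq> 0" "v \<bullet> y2 \<noteq> 0"
  proof -
    have "\<not> W \<subseteq> {t. \<exists>i. t $ i = 0} \<union> {t. v \<bullet> t = 0}" using nonneg negligible_subset[OF neg2] by metis
    then show ?thesis using that by auto
  qed
  then show ?thesis using that[of y1 y2 j k] y1 by (simp add: v)
qed

text \<open>Compactness makes the positivity of \<open>cross_sq t1 d + cross_sq t2 d\<close> uniform
  over two balls and all unit directions. The ball in the disjunction depends on \<open>d\<close>,
  but the bound is uniform over that ball, so it will serve all sample points in it at once.\<close>

lemma obtain_cross_sq_balls:
  fixes W :: "(real ^ 'n) set"
  assumes "CARD('n) \<ge> 2" "open W" "W \<noteq> {}"
  obtains y1 y2 e c where "0 < e" "0 < c" "cball y1 e \<subseteq> W" "cball y2 e \<subseteq> W"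
    "\<And>t i. t \<in> cball y1 e \<union> cball y2 e \<Longrightarrow> t $ i \<noteq> 0"
    "\<And>d. (\<forall>t\<in>cball y1 e. c * (norm d)\<^sup>2 \<le> cross_sq t d) \<or> (\<forall>t\<in>cball y2 e. c * (norm d)\<^sup>2 \<le> cross_sq t d)"
proof -
  obtain y1 y2 j k where y: "y1 \<in> W" "y2 \<in> W" "\<And>i. y1 $ i \<noteq> 0" "\<And>i. y2 $ i \<noteq> 0"
    "y1 $ j * y2 $ k \<noteq> y1 $ k * y2 $ j"
    using obtain_nonparallel_points[OF assms] by blast
  define V where "V = W \<inter> {t. \<forall>j. t $ j \<noteq> 0}"
  have V: "open V" unfolding V_def by (intro open_Int assms open_nonzero_components)
  have "open (V \<times> V \<inter> {p. fst p $ j * snd p $ k \<noteq> fst p $ k * snd p $ j})"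
    by (intro open_Int open_Times V open_Collect_neq continuous_intros)
  then obtain A B where AB: "open A" "open B" "(y1, y2) \<in> A \<times> B"
    "A \<times> B \<subseteq> V \<times> V \<inter> {p. fst p $ j * snd p $ k \<noteq> fst p $ k * snd p $ j}"
    by (rule open_prod_elim[where x = "(y1, y2)"]) (use y in \<open>auto simp: V_def\<close>)
  obtain e1 where e1: "0 < e1" "cball y1 e1 \<subseteq> A" using AB open_contains_cball by blast
  obtain e2 where e2: "0 < e2" "cball y2 e2 \<subseteq> B" using AB open_contains_cball by blast
  define e where "e = min e1 e2"
  have e: "0 < e" "cball y1 e \<subseteq> A" "cball y2 e \<subseteq> B"
    using e1 e2 by (auto simp: e_def)
  have sub: "cball y1 e \<subseteq> V" "cball y2 e \<subseteq> V" using e AB by blast+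
  have ne: "t1 $ j * t2 $ k \<noteq> t1 $ k * t2 $ j" if "t1 \<in> cball y1 e" "t2 \<in> cball y2 e" for t1 t2
  proof -
    have "(t1, t2) \<in> A \<times> B" using that e by blast
    then have "(t1, t2) \<in> {p. fst p $ j * snd p $ k \<noteq> fst p $ k * snd p $ j}" using AB(4) by blast
    then show ?thesis by simp
  qed
  define S where "S = cball y1 e \<times> cball y2 e \<times> sphere (0 :: real ^ 'n) 1"
  have "compact S" unfolding S_def by (intro compact_Times compact_cball compact_sphere)
  moreover have "S \<noteq> {}"
    using e by (auto simp: S_def intro!: exI[of _ y1] exI[of _ y2] exI[of _ "axis j 1"])
  moreover have "continuous_on S (\<lambda>(t1, t2, d). cross_sq t1 d + cross_sq t2 d)"
    unfolding cross_sq_def case_prod_unfold by (intro continuous_intros)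
  ultimately obtain s where s: "s \<in> S" "\<And>z. z \<in> S \<Longrightarrow>
      (\<lambda>(t1, t2, d). cross_sq t1 d + cross_sq t2 d) s \<le> (\<lambda>(t1, t2, d). cross_sq t1 d + cross_sq t2 d) z"
    by (rule continuous_attains_inf[THEN bexE]) blast
  define m where "m = (\<lambda>(t1, t2, d). cross_sq t1 d + cross_sq t2 d) s"
  have m: "0 < m"
    using s(1) ne unfolding m_def S_def by (auto intro!: cross_sq_add_pos[of _ j _ k])
  \<comment> \<open>From the unit sphere to arbitrary \<open>d\<close>, since both sides are
    homogeneous of degree 2.\<close>
  have main: "m * (norm d)\<^sup>2 \<le> cross_sq t1 d + cross_sq t2 d" if "t1 \<in> cball y1 e" "t2 \<in> cball y2 e" for t1 t2 d
  proof (cases "d = 0")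
    case False
    define v where "v = (1 / norm d) *\<^sub>R d"
    have d: "d = norm d *\<^sub>R v" using False by (simp add: v_def)
    have "(t1, t2, v) \<in> S" using that False by (simp add: S_def v_def)
    then have "m \<le> cross_sq t1 v + cross_sq t2 v" using s(2) by (fastforce simp: m_def)
    then have "(norm d)\<^sup>2 * m \<le> (norm d)\<^sup>2 * (cross_sq t1 v + cross_sq t2 v)"
      by (intro mult_left_mono) auto
    also have "\<dots> = cross_sq t1 d + cross_sq t2 d"
      using cross_sq_scaleR[of t1 "norm d" v] cross_sq_scaleR[of t2 "norm d" v] by (simp add: algebra_simps flip: d)
    finally show ?thesis by (simp add: mult.commute)
  qed (simp add: cross_sq_nonneg add_nonneg_nonneg)
  show ?thesis
  proof (rule that[of e "m / 2" y1 y2])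
    \<comment> \<open>If each ball had a point violating its bound, the two values would add up to
      less than \<open>m * (norm d)\<^sup>2\<close>.\<close>
    show "(\<forall>t\<in>cball y1 e. m / 2 * (norm d)\<^sup>2 \<le> cross_sq t d) \<or> (\<forall>t\<in>cball y2 e. m / 2 * (norm d)\<^sup>2 \<le> cross_sq t d)" for d
    proof (rule ccontr)
      assume "\<not> ?thesis"
      then obtain t1 t2 where "t1 \<in> cball y1 e" "t2 \<in> cball y2 e"
        "cross_sq t1 d < m / 2 * (norm d)\<^sup>2" "cross_sq t2 d < m / 2 * (norm d)\<^sup>2"
        by (auto simp: not_le)
      then show False using main[of t1 t2 d] by simp
    qed
  qed (use e m sub in \<open>auto simp: V_def\<close>)
qed

text \<open>Combines the strict subgradient inequality on each ball with the lower bound on the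
  minors, which turns the \<open>cross_sq\<close> term into a genuine quadratic in
  \<open>norm d\<close>.\<close>

lemma obtain_growth_balls:
  fixes W :: "(real ^ 'n) set"
  assumes "CARD('n) \<ge> 2" "open W" "W \<noteq> {}" and r: "1 < r"
  obtains y1 y2 e c where "0 < e" "0 < c" "cball y1 e \<subseteq> W" "cball y2 e \<subseteq> W"
    "\<And>d. norm d \<le> e \<Longrightarrow> \<exists>y\<in>{y1, y2}. \<forall>t\<in>cball y e.
       lr_norm r t + lr_grad r t \<bullet> d + c * (norm d)\<^sup>2 \<le> lr_norm r (t + d)"
proof -
  obtain y1 y2 e c where y: "0 < e" "0 < c" "cball y1 e \<subseteq> W" "cball y2 e \<subseteq> W"
    "\<And>t i. t \<in> cball y1 e \<union> cball y2 e \<Longrightarrow> t $ i \<noteq> 0"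
    "\<And>d. (\<forall>t\<in>cball y1 e. c * (norm d)\<^sup>2 \<le> cross_sq t d) \<or> (\<forall>t\<in>cball y2 e. c * (norm d)\<^sup>2 \<le> cross_sq t d)"
    by (rule obtain_cross_sq_balls[OF assms(1-3)]) (rule that)
  have nz1: "\<And>t i. t \<in> cball y1 e \<Longrightarrow> t $ i \<noteq> 0" and nz2: "\<And>t i. t \<in> cball y2 e \<Longrightarrow> t $ i \<noteq> 0"
    using y(5) by blast+
  obtain c1 where c1: "0 < c1" "\<And>t d. t \<in> cball y1 e \<Longrightarrow> t + d \<in> cball y1 e \<Longrightarrow>
    lr_norm r t + lr_grad r t \<bullet> d + c1 * cross_sq t d \<le> lr_norm r (t + d)"
    by (rule lr_norm_strict_subgradient[OF r compact_cball[of y1 e] convex_cball[of y1 e] nz1]) (assumption, rule that)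
  obtain c2 where c2: "0 < c2" "\<And>t d. t \<in> cball y2 e \<Longrightarrow> t + d \<in> cball y2 e \<Longrightarrow>
    lr_norm r t + lr_grad r t \<bullet> d + c2 * cross_sq t d \<le> lr_norm r (t + d)"
    by (rule lr_norm_strict_subgradient[OF r compact_cball[of y2 e] convex_cball[of y2 e] nz2]) (assumption, rule that)
  define b where "b = min c1 c2 * c"
  have *: "lr_norm r t + lr_grad r t \<bullet> d + b * (norm d)\<^sup>2 \<le> lr_norm r (t + d)"
    if "lr_norm r t + lr_grad r t \<bullet> d + c' * cross_sq t d \<le> lr_norm r (t + d)"
       "c * (norm d)\<^sup>2 \<le> cross_sq t d" "c' = c1 \<or> c' = c2" for t d c'
  proof -
    have "b * (norm d)\<^sup>2 \<le> c' * (c * (norm d)\<^sup>2)"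
      using that(3) y c1 c2 unfolding b_def mult.assoc by (intro mult_right_mono) auto
    also have "\<dots> \<le> c' * cross_sq t d" using that c1 c2 by (intro mult_left_mono) auto
    finally show ?thesis using that(1) by simp
  qed
  \<comment> \<open>The radius is halved because the strict inequality needs both \<open>t\<close>
    and \<open>t + d\<close> in the ball.\<close>
  have in_ball: "t \<in> cball y e" "t + d \<in> cball y e" if "t \<in> cball y (e / 2)" "norm d \<le> e / 2" for y t d :: "real ^ 'n"
  proof -
    show "t \<in> cball y e" using that y by simp
    have "dist y (t + d) \<le> dist y t + norm d"
      using dist_triangle[of y "t + d" t] by (simp add: dist_norm)
    then show "t + d \<in> cball y e" using that by simp
  qed
  show ?thesis
  proof (rule that[of "e / 2" b y1 y2])
    show "0 < b" using c1 c2 y by (simp add: b_def)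
    show "\<exists>y\<in>{y1, y2}. \<forall>t\<in>cball y (e / 2). lr_norm r t + lr_grad r t \<bullet> d + b * (norm d)\<^sup>2 \<le> lr_norm r (t + d)"
      if d: "norm d \<le> e / 2" for d
    proof (cases "\<forall>t\<in>cball y1 e. c * (norm d)\<^sup>2 \<le> cross_sq t d")
      case True
      then show ?thesis using *[OF c1(2)] in_ball[OF _ d] by blast
    next
      case False
      then show ?thesis using y(6)[of d] *[OF c2(2)] in_ball[OF _ d] by blast
    qed
    show "cball y1 (e / 2) \<subseteq> W" "cball y2 (e / 2) \<subseteq> W"
      using y(1,3,4) subset_cball[of "e / 2" e] by (auto intro: order_trans)
  qed (use y in auto)
qed

subsection \<open>The gradient at the geometric quantile and Hoeffding bounds\<close>

lemma Phi_measurable [measurable]: "Phi r u \<in> borel_measurable borel"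
  unfolding Phi_def [abs_def] by measurable

lemma abs_lr_norm_diff_le:
  assumes "1 < r"
  shows "\<bar>lr_norm r s - lr_norm r t\<bar> \<le> lr_norm r (s - t)"
  using lr_norm_triangle[OF assms, of "s - t" t] lr_norm_triangle[OF assms, of "t - s" s]
    lr_norm_minus[of r "s - t"] by simp

lemma abs_Phi_diff_le:
  assumes "1 < r"
  shows "\<bar>Phi r u s - Phi r u t\<bar> \<le> lr_norm r (s - t) + \<bar>u \<bullet> (s - t)\<bar>"
  using abs_lr_norm_diff_le[OF assms, of s t] unfolding Phi_def inner_diff_right by linarith

text \<open>Coordinate hyperplanes are Lebesgue null sets, hence \<open>P\<close>-null. This makes
  the norm differentiable at \<open>x - \<theta>\<close> for almost every observation
  \<open>x\<close>.\<close>

lemma AE_density_components_neq: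
  fixes \<theta> :: "real ^ 'n"
  assumes "has_lebesgue_density P p"
  shows "AE x in P. \<forall>j. (x - \<theta>) $ j \<noteq> 0"
proof -
  have "AE x in lborel. (x - \<theta>) $ j \<noteq> 0" for j
  proof -
    have "negligible {x :: real ^ 'n. x $ j = \<theta> $ j}"
      using negligible_hyperplane[of "axis j 1 :: real ^ 'n" "\<theta> $ j"] by (simp add: inner_axis')
    moreover have "{x :: real ^ 'n. x $ j = \<theta> $ j} \<in> sets borel"
      by (intro borel_closed closed_Collect_eq continuous_intros)
    ultimately have "{x :: real ^ 'n. x $ j = \<theta> $ j} \<in> null_sets lborel"
      by (simp add: negligible_iff_null_sets null_sets_completion_iff)
    then have "AE x in lborel. x \<notin> {x :: real ^ 'n. x $ j = \<theta> $ j}" by (rule AE_not_in)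
    then show ?thesis by eventually_elim simp
  qed
  then have "AE x in lborel. \<forall>j. (x - \<theta>) $ j \<noteq> 0"
    by (subst AE_all_countable) auto
  then have "AE x in density lborel (\<lambda>x. ennreal (p x)). \<forall>j. (x - \<theta>) $ j \<noteq> 0"
    using assms by (subst AE_density) (auto simp: has_lebesgue_density_def)
  then show ?thesis using assms unfolding has_lebesgue_density_def by metis
qed

text \<open>One-sided difference quotients of the risk at a minimiser are nonnegative. They converge
  by dominated convergence, as the loss is Lipschitz. The sign in the conclusion is reversed because
  the parameter enters as \<open>x - \<theta>\<close>.\<close>

lemma geometric_quantile_directional_derivative_nonneg:
  fixes u \<theta> v :: "real ^ 'n"
  assumes r: "1 < r" and P: "prob_space P" "sets P = sets borel"
    and AE: "AE x in P. \<forall>j. (x - \<theta>) $ j \<noteq> 0"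
    and quantile: "is_geometric_quantile r u P \<theta>"
  shows "(\<integral>x. (lr_grad r (x - \<theta>) + u) \<bullet> v \<partial>P) \<le> 0"
proof -
  interpret prob_space P by fact
  note [measurable_cong] = P(2)
  define s where "s = (\<lambda>n. inverse (real (Suc n)))"
  have s: "0 < s n" for n by (simp add: s_def)
  have bnd: "\<bar>Phi r u (x - \<xi>) - Phi r u (x - \<theta>)\<bar> \<le> lr_norm r (\<xi> - \<theta>) + \<bar>u \<bullet> (\<xi> - \<theta>)\<bar>" for x \<xi> \<theta>
    using abs_Phi_diff_le[OF r, of u "x - \<xi>" "x - \<theta>"] lr_norm_minus[of r "\<xi> - \<theta>"]
    by (simp add: inner_diff_right abs_minus_commute)
  have int: "integrable P (\<lambda>x. Phi r u (x - \<xi>) - Phi r u x)" for \<xi>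
    using bnd[of _ \<xi> 0] by (intro integrable_const_bound[where B = "lr_norm r \<xi> + \<bar>u \<bullet> \<xi>\<bar>"]) auto
  define D where "D = (\<lambda>n x. (Phi r u (x - (\<theta> + s n *\<^sub>R v)) - Phi r u (x - \<theta>)) / s n)"
  have "(\<lambda>n. integral\<^sup>L P (D n)) \<longlonglongrightarrow> (\<integral>x. - ((lr_grad r (x - \<theta>) + u) \<bullet> v) \<partial>P)"
  proof (rule integral_dominated_convergence[where w = "\<lambda>_. lr_norm r v + \<bar>u \<bullet> v\<bar>"])
    show "AE x in P. (\<lambda>n. D n x) \<longlonglongrightarrow> - ((lr_grad r (x - \<theta>) + u) \<bullet> v)"
      using AE
    proof eventually_elim
      fix x assume x: "\<forall>j. (x - \<theta>) $ j \<noteq> 0"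
      have "((\<lambda>s. lr_norm r ((x - \<theta>) + s *\<^sub>R (- v))) has_real_derivative lr_grad r (x - \<theta>) \<bullet> (- v)) (at 0)"
        using lr_norm_line_derivs(1)[OF r, of "x - \<theta>" 0 "- v"] x by simp
      moreover have "((\<lambda>s. u \<bullet> ((x - \<theta>) + s *\<^sub>R (- v))) has_real_derivative u \<bullet> (- v)) (at 0)"
        unfolding inner_add_right inner_scaleR_right by (auto intro!: derivative_eq_intros)
      ultimately have "((\<lambda>s. Phi r u ((x - \<theta>) + s *\<^sub>R (- v))) has_real_derivative
          lr_grad r (x - \<theta>) \<bullet> (- v) + u \<bullet> (- v)) (at 0)"
        unfolding Phi_def by (rule DERIV_add)
      then have *: "((\<lambda>h. (Phi r u ((x - \<theta>) + h *\<^sub>R (- v)) - Phi r u (x - \<theta>)) / h) \<longlongrightarrow>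
          lr_grad r (x - \<theta>) \<bullet> (- v) + u \<bullet> (- v)) (at 0)"
        by (simp add: DERIV_def)
      have "filterlim s (at 0) sequentially"
        using LIMSEQ_inverse_real_of_nat by (intro filterlim_atI) (auto simp: s_def)
      from filterlim_compose[OF * this]
      show "(\<lambda>n. D n x) \<longlonglongrightarrow> - ((lr_grad r (x - \<theta>) + u) \<bullet> v)"
        by (simp add: D_def inner_add_left algebra_simps)
    qed
    show "AE x in P. norm (D n x) \<le> lr_norm r v + \<bar>u \<bullet> v\<bar>" for n
    proof (rule AE_I2)
      fix x
      have "\<bar>Phi r u (x - (\<theta> + s n *\<^sub>R v)) - Phi r u (x - \<theta>)\<bar> \<le> s n * (lr_norm r v + \<bar>u \<bullet> v\<bar>)"
        using bnd[of x "\<theta> + s n *\<^sub>R v" \<theta>] s[of n] r by (simp add: lr_norm_scaleR abs_mult distrib_left)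
      then show "norm (D n x) \<le> lr_norm r v + \<bar>u \<bullet> v\<bar>"
        using s[of n] by (simp add: D_def abs_divide pos_divide_le_eq mult.commute)
    qed
  qed (auto simp: D_def)
  \<comment> \<open>\<open>Phi r u x\<close> is subtracted from both terms before the integral is
    split: \<open>P\<close> has no assumed moments, so only the differences are known to be
    integrable.\<close>
  moreover have "0 \<le> integral\<^sup>L P (D n)" for n
  proof -
    have "integral\<^sup>L P (D n) = (\<integral>x. ((Phi r u (x - (\<theta> + s n *\<^sub>R v)) - Phi r u x) - (Phi r u (x - \<theta>) - Phi r u x)) / s n \<partial>P)"
      by (simp add: D_def)
    also have "\<dots> = ((\<integral>x. Phi r u (x - (\<theta> + s n *\<^sub>R v)) - Phi r u x \<partial>P) - (\<integral>x. Phi r u (x - \<theta>) - Phi r u x \<partial>P)) / s n"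
      by (subst Bochner_Integration.integral_diff[symmetric, OF int int]) (rule integral_divide_zero)
    also have "\<dots> \<ge> 0"
      using quantile s[of n] unfolding is_geometric_quantile_def is_arg_min_def
      by (intro divide_nonneg_pos) (auto simp: not_less)
    finally show ?thesis .
  qed
  ultimately have "0 \<le> (\<integral>x. - ((lr_grad r (x - \<theta>) + u) \<bullet> v) \<partial>P)"
    by (intro LIMSEQ_le_const) auto
  then show ?thesis by simp
qed

text \<open>The directional derivative is linear in the direction, so applying the sign bound to
  both \<open>axis j 1\<close> and its negative forces it to vanish.\<close>

lemma geometric_quantile_mean_gradient_eq_0:
  fixes u \<theta> :: "real ^ 'n"
  assumes "1 < r" "prob_space P" "sets P = sets borel"
    and "AE x in P. \<forall>j. (x - \<theta>) $ j \<noteq> 0"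
    and "is_geometric_quantile r u P \<theta>"
  shows "(\<integral>x. (lr_grad r (x - \<theta>) + u) $ j \<partial>P) = 0"
proof -
  note * = geometric_quantile_directional_derivative_nonneg[OF assms]
  have "0 \<le> (\<integral>x. (lr_grad r (x - \<theta>) + u) $ j \<partial>P)"
    using *[of "- axis j 1"] by (simp only: inner_minus_right inner_axis integral_minus) simp
  then show ?thesis
    using *[of "axis j 1"] by (simp add: inner_axis)
qed

text \<open>Hoeffding's inequality for summands in \<open>[-b, b]\<close>; the squared ranges add up
  to \<open>4 * n * b\<^sup>2\<close>, which gives the exponent.\<close>

lemma iid_sum_deviation:
  fixes \<phi> :: "real ^ 'n \<Rightarrow> real"
  assumes M: "prob_space M" and X: "prob_space.indep_vars M (\<lambda>_. borel) X {1..}"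
    and P: "\<forall>i\<ge>1. distr M borel (X i) = P"
    and \<phi> [measurable]: "\<phi> \<in> borel_measurable borel" and b: "\<And>x. \<bar>\<phi> x\<bar> \<le> b" "0 < b"
    and n: "1 \<le> n" and \<tau>: "0 \<le> \<tau>"
  shows "measure M {w \<in> space M. \<tau> \<le> \<bar>(\<Sum>i=1..n. \<phi> (X i w)) - real n * (\<integral>x. \<phi> x \<partial>P)\<bar>}
    \<le> 2 * exp (- \<tau>\<^sup>2 / (2 * real n * b\<^sup>2))"
proof -
  interpret prob_space M by fact
  have "indep_vars (\<lambda>_. borel) (\<lambda>i w. \<phi> (X i w)) {1..n}"
    by (rule indep_vars_compose2[OF indep_vars_subset[OF X]]) auto
  then interpret Hoeffding_ineq M "{1..n}" "\<lambda>i w. \<phi> (X i w)" "\<lambda>_. - b" "\<lambda>_. b" "\<Sum>i=1..n. expectation (\<lambda>w. \<phi> (X i w))"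
    by unfold_locales (use b in \<open>auto simp: abs_le_iff minus_le_iff\<close>)
  have "expectation (\<lambda>w. \<phi> (X i w)) = (\<integral>x. \<phi> x \<partial>P)" if "i \<in> {1..n}" for i
  proof -
    have "X i \<in> measurable M borel" using X that unfolding indep_vars_def by auto
    then show ?thesis using P that by (subst integral_distr[symmetric, where N = borel]) auto
  qed
  then have "(\<Sum>i=1..n. expectation (\<lambda>w. \<phi> (X i w))) = real n * (\<integral>x. \<phi> x \<partial>P)" by simp
  moreover have "(\<Sum>i=1..n. (b - - b)\<^sup>2) = real n * (4 * b\<^sup>2)" by (simp add: power2_eq_square)
  ultimately show ?thesis
    using Hoeffding_ineq_abs_ge[OF \<tau>] n b by (simp add: field_simps)
qed

subsection \<open>Tail bounds for unnormalised posteriors\<close>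

text \<open>On \<open>A\<close>, half of \<open>F\<close> is at least \<open>b / 2\<close> and the
  other half dominates \<open>F\<close> at the contracted point, so \<open>exp (- F)\<close> is at
  most \<open>exp (- b / 2)\<close> times its value there. Undoing the contraction costs its
  Jacobian \<open>2 ^ CARD('n)\<close>, and comparing the prior densities at the two points costs
  \<open>C / c\<close>.\<close>

lemma posterior_near_tail_bound:
  fixes F \<pi> :: "real ^ 'n \<Rightarrow> real"
  assumes [measurable]: "F \<in> borel_measurable borel"
    and star: "\<And>\<theta>. F (\<theta>0 + (1 / 2) *\<^sub>R (\<theta> - \<theta>0)) \<le> F \<theta> / 2"
    and Q: "has_lebesgue_density Q \<pi>"
    and \<pi>: "\<And>\<theta>. \<theta> \<in> cball \<theta>0 \<rho> \<Longrightarrow> c \<le> \<pi> \<theta>" "\<And>\<theta>. \<theta> \<in> cball \<theta>0 \<rho> \<Longrightarrow> \<pi> \<theta> \<le> C"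
    and c: "0 < c" and A [measurable]: "A \<in> sets borel" "A \<subseteq> cball \<theta>0 \<rho>"
    and b: "\<And>\<theta>. \<theta> \<in> A \<Longrightarrow> b \<le> F \<theta>"
  shows "(\<integral>\<^sup>+\<theta>. indicator A \<theta> * ennreal (exp (- F \<theta>)) \<partial>Q)
    \<le> ennreal (C / c * 2 ^ CARD('n) * exp (- b / 2)) * (\<integral>\<^sup>+\<theta>. ennreal (exp (- F \<theta>)) \<partial>Q)"
proof (cases "A = {}")
  case True
  then show ?thesis by simp
next
  case False
  have [measurable]: "\<pi> \<in> borel_measurable borel" and \<pi>_nonneg: "\<And>x. 0 \<le> \<pi> x"
    and Q_eq: "Q = density lborel (\<lambda>x. ennreal (\<pi> x))"
    using Q by (auto simp: has_lebesgue_density_def)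
  have C: "0 \<le> C" using False A \<pi> \<pi>_nonneg by (meson equals0I order_trans subsetD)
  define B where "B = cball \<theta>0 \<rho>"
  have [measurable]: "B \<in> sets borel" by (simp add: B_def)
  define h where "h = (\<lambda>\<theta>. \<theta>0 + (1 / 2) *\<^sub>R (\<theta> - \<theta>0))"
  have h [measurable]: "h \<in> borel_measurable borel" by (simp add: h_def)
  define K where "K = C * exp (- b / 2)"
  have K: "0 \<le> K" using C by (simp add: K_def)
  have "(\<integral>\<^sup>+\<theta>. indicator A \<theta> * ennreal (exp (- F \<theta>)) \<partial>Q)
      = (\<integral>\<^sup>+\<theta>. ennreal (\<pi> \<theta>) * (indicator A \<theta> * ennreal (exp (- F \<theta>))) \<partial>lborel)"
    unfolding Q_eq by (rule nn_integral_density) auto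
  also have "\<dots> \<le> (\<integral>\<^sup>+\<theta>. ennreal K * (indicator B \<theta> * ennreal (exp (- F (h \<theta>)))) \<partial>lborel)"
  proof (rule nn_integral_mono)
    fix \<theta>
    show "ennreal (\<pi> \<theta>) * (indicator A \<theta> * ennreal (exp (- F \<theta>))) \<le> ennreal K * (indicator B \<theta> * ennreal (exp (- F (h \<theta>))))"
    proof (cases "\<theta> \<in> A")
      case True
      then have "\<theta> \<in> B" using A by (auto simp: B_def)
      have "\<pi> \<theta> * exp (- F \<theta>) \<le> C * exp (- b / 2 + - F (h \<theta>))"
        using star[of \<theta>] b[OF True] \<pi>(2)[of \<theta>] \<pi>_nonneg[of \<theta>] \<open>\<theta> \<in> B\<close> C
        by (intro mult_mono) (auto simp: h_def B_def)
      also have "\<dots> = K * exp (- F (h \<theta>))" using exp_add[of "- b / 2" "- F (h \<theta>)"] by (simp add: K_def)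
      finally show ?thesis
        using True \<open>\<theta> \<in> B\<close> K \<pi>_nonneg[of \<theta>] by (simp flip: ennreal_mult')
    qed simp
  qed
  also have "\<dots> = ennreal K * (\<integral>\<^sup>+\<theta>. indicator B \<theta> * ennreal (exp (- F (h \<theta>))) \<partial>lborel)"
    by (rule nn_integral_cmult) measurable
  finally have 1: "(\<integral>\<^sup>+\<theta>. indicator A \<theta> * ennreal (exp (- F \<theta>)) \<partial>Q)
      \<le> ennreal K * (\<integral>\<^sup>+\<theta>. indicator B \<theta> * ennreal (exp (- F (h \<theta>))) \<partial>lborel)" .
  have "(\<integral>\<^sup>+\<theta>. indicator B \<theta> * ennreal (exp (- F (h \<theta>))) \<partial>lborel)
      = (\<integral>\<^sup>+\<theta>. indicator B \<theta> * ennreal (exp (- F (h \<theta>)))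
          \<partial>density (distr lborel borel (\<lambda>x. - \<theta>0 + 2 *\<^sub>R x)) (\<lambda>_. ennreal (\<bar>2\<bar> ^ DIM(real ^ 'n))))"
    using lborel_affine[of 2 "- \<theta>0"] by simp
  also have "\<dots> = (\<integral>\<^sup>+\<psi>. ennreal (2 ^ CARD('n)) * (indicator B (- \<theta>0 + 2 *\<^sub>R \<psi>) * ennreal (exp (- F (h (- \<theta>0 + 2 *\<^sub>R \<psi>))))) \<partial>lborel)"
    by (simp add: nn_integral_density nn_integral_distr)
  also have "\<dots> \<le> (\<integral>\<^sup>+\<psi>. ennreal (2 ^ CARD('n) / c) * (ennreal (\<pi> \<psi>) * ennreal (exp (- F \<psi>))) \<partial>lborel)"
  proof (rule nn_integral_mono)
    fix \<psi>
    have h: "h (- \<theta>0 + 2 *\<^sub>R \<psi>) = \<psi>"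
      by (simp add: h_def algebra_simps flip: scaleR_2)
    show "ennreal (2 ^ CARD('n)) * (indicator B (- \<theta>0 + 2 *\<^sub>R \<psi>) * ennreal (exp (- F (h (- \<theta>0 + 2 *\<^sub>R \<psi>)))))
      \<le> ennreal (2 ^ CARD('n) / c) * (ennreal (\<pi> \<psi>) * ennreal (exp (- F \<psi>)))"
    proof (cases "- \<theta>0 + 2 *\<^sub>R \<psi> \<in> B")
      case True
      \<comment> \<open>If the doubled point lies in the ball then so does \<open>\<psi>\<close>, at
        half the distance from the centre; hence the lower bound on the density applies at
        \<open>\<psi>\<close>.\<close>
      have "dist \<theta>0 (- \<theta>0 + 2 *\<^sub>R \<psi>) = 2 * dist \<theta>0 \<psi>"
      proof -
        have "\<theta>0 - (- \<theta>0 + 2 *\<^sub>R \<psi>) = 2 *\<^sub>R (\<theta>0 - \<psi>)" by (simp add: algebra_simps scaleR_2)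
        then show ?thesis by (simp add: dist_norm)
      qed
      then have "\<psi> \<in> cball \<theta>0 \<rho>" using True zero_le_dist[of \<theta>0 \<psi>] unfolding B_def mem_cball by linarith
      then have "1 \<le> \<pi> \<psi> / c" using \<pi>(1) c by simp
      then have "2 ^ CARD('n) * exp (- F \<psi>) * 1 \<le> 2 ^ CARD('n) * exp (- F \<psi>) * (\<pi> \<psi> / c)"
        by (intro mult_left_mono) auto
      then show ?thesis
        using True \<pi>_nonneg[of \<psi>] c unfolding h
        by (simp flip: ennreal_mult' ennreal_mult'' add: mult_ac)
    qed simp
  qed
  also have "\<dots> = ennreal (2 ^ CARD('n) / c) * (\<integral>\<^sup>+\<psi>. ennreal (\<pi> \<psi>) * ennreal (exp (- F \<psi>)) \<partial>lborel)"
    by (rule nn_integral_cmult) measurable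
  also have "(\<integral>\<^sup>+\<psi>. ennreal (\<pi> \<psi>) * ennreal (exp (- F \<psi>)) \<partial>lborel) = (\<integral>\<^sup>+\<psi>. ennreal (exp (- F \<psi>)) \<partial>Q)"
    unfolding Q_eq by (rule nn_integral_density[symmetric]) auto
  finally have 2: "(\<integral>\<^sup>+\<theta>. indicator B \<theta> * ennreal (exp (- F (h \<theta>))) \<partial>lborel)
      \<le> ennreal (2 ^ CARD('n) / c) * (\<integral>\<^sup>+\<psi>. ennreal (exp (- F \<psi>)) \<partial>Q)" .
  have "K * (2 ^ CARD('n) / c) = C / c * 2 ^ CARD('n) * exp (- b / 2)" by (simp add: K_def)
  then have "ennreal (C / c * 2 ^ CARD('n) * exp (- b / 2)) = ennreal K * ennreal (2 ^ CARD('n) / c)"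
    using K by (simp only: ennreal_mult'[symmetric])
  then show ?thesis
    using order_trans[OF 1 mult_left_mono[OF 2 zero_le]] by (simp only: mult.assoc)
qed

text \<open>The left side is at most \<open>exp (- b)\<close> because \<open>Q\<close> has total
  mass 1, while the small ball alone contributes at least \<open>c * exp (- 1)\<close> times its
  volume to the integral on the right.\<close>

lemma posterior_far_tail_bound:
  fixes F \<pi> :: "real ^ 'n \<Rightarrow> real"
  assumes [measurable]: "F \<in> borel_measurable borel"
    and Q: "has_lebesgue_density Q \<pi>" "prob_space Q"
    and \<pi>: "\<And>\<theta>. \<theta> \<in> cball \<theta>0 \<eta> \<Longrightarrow> c \<le> \<pi> \<theta>"
    and c: "0 < c" and \<eta>: "0 < \<eta>" "\<And>\<theta>. \<theta> \<in> cball \<theta>0 \<eta> \<Longrightarrow> F \<theta> \<le> 1"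
    and A [measurable]: "A \<in> sets borel" and b: "\<And>\<theta>. \<theta> \<in> A \<Longrightarrow> b \<le> F \<theta>"
  shows "(\<integral>\<^sup>+\<theta>. indicator A \<theta> * ennreal (exp (- F \<theta>)) \<partial>Q)
    \<le> ennreal (exp (1 - b) / (c * measure lborel (cball \<theta>0 \<eta>))) * (\<integral>\<^sup>+\<theta>. ennreal (exp (- F \<theta>)) \<partial>Q)"
proof -
  have [measurable]: "\<pi> \<in> borel_measurable borel" and \<pi>_nonneg: "\<And>x. 0 \<le> \<pi> x"
    and Q_eq: "Q = density lborel (\<lambda>x. ennreal (\<pi> x))"
    using Q by (auto simp: has_lebesgue_density_def)
  define B where "B = cball \<theta>0 \<eta>"
  have [measurable]: "B \<in> sets borel" by (simp add: B_def)
  define V where "V = measure lborel B"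
  have V: "0 < V" unfolding V_def B_def using \<eta> by (simp add: content_cball_pos)
  have "(\<integral>\<^sup>+\<theta>. indicator A \<theta> * ennreal (exp (- F \<theta>)) \<partial>Q) \<le> (\<integral>\<^sup>+\<theta>. ennreal (exp (- b)) \<partial>Q)"
    using b by (intro nn_integral_mono) (auto split: split_indicator)
  also have "\<dots> = ennreal (exp (- b))"
    using prob_space.emeasure_space_1[OF Q(2)] by simp
  finally have upper: "(\<integral>\<^sup>+\<theta>. indicator A \<theta> * ennreal (exp (- F \<theta>)) \<partial>Q) \<le> ennreal (exp (- b))" .
  have eV: "emeasure lborel B = ennreal V"
    unfolding V_def using emeasure_lborel_cball_finite[of \<theta>0 \<eta>]
    by (intro emeasure_eq_ennreal_measure) (auto simp: B_def)
  have "ennreal (c * exp (- 1) * V) = (\<integral>\<^sup>+\<theta>. ennreal (c * exp (- 1)) * indicator B \<theta> \<partial>lborel)"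
    using c by (simp add: nn_integral_cmult_indicator ennreal_mult' eV)
  also have "\<dots> \<le> (\<integral>\<^sup>+\<theta>. ennreal (\<pi> \<theta>) * ennreal (exp (- F \<theta>)) \<partial>lborel)"
  proof (rule nn_integral_mono)
    fix \<theta>
    show "ennreal (c * exp (- 1)) * indicator B \<theta> \<le> ennreal (\<pi> \<theta>) * ennreal (exp (- F \<theta>))"
    proof (cases "\<theta> \<in> B")
      case True
      then have "c * exp (- 1) \<le> \<pi> \<theta> * exp (- F \<theta>)"
        using \<pi>[of \<theta>] \<eta>(2)[of \<theta>] \<pi>_nonneg[of \<theta>] by (intro mult_mono) (auto simp: B_def)
      then show ?thesis using True \<pi>_nonneg[of \<theta>] by (simp flip: ennreal_mult')
    qed simp
  qed
  also have "\<dots> = (\<integral>\<^sup>+\<theta>. ennreal (exp (- F \<theta>)) \<partial>Q)"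
    unfolding Q_eq by (rule nn_integral_density[symmetric]) auto
  finally have lower: "ennreal (c * exp (- 1) * V) \<le> (\<integral>\<^sup>+\<theta>. ennreal (exp (- F \<theta>)) \<partial>Q)" .
  have "exp (- b) = exp (1 - b) / (c * V) * (c * exp (- 1) * V)"
    using c V by (simp add: field_simps flip: exp_add)
  then have "ennreal (exp (- b)) = ennreal (exp (1 - b) / (c * V)) * ennreal (c * exp (- 1) * V)"
    using c V by (simp flip: ennreal_mult')
  also have "\<dots> \<le> ennreal (exp (1 - b) / (c * V)) * (\<integral>\<^sup>+\<theta>. ennreal (exp (- F \<theta>)) \<partial>Q)"
    by (intro mult_left_mono lower) simp
  finally show ?thesis using upper unfolding V_def B_def by (rule order_trans[rotated])
qed

subsection \<open>Growth of the empirical excess risk\<close>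

text \<open>Convexity of the loss in the parameter along the segment from \<open>\<theta>0\<close>
  to \<open>\<theta>\<close>.\<close>

lemma loss_excess_scaled_le:
  assumes r: "1 < r" and s: "0 \<le> s" "s \<le> 1"
  shows "loss r u (\<theta>0 + s *\<^sub>R (\<theta> - \<theta>0)) x - loss r u \<theta>0 x \<le> s * (loss r u \<theta> x - loss r u \<theta>0 x)"
proof -
  have eq: "x - (\<theta>0 + s *\<^sub>R (\<theta> - \<theta>0)) = s *\<^sub>R (x - \<theta>) + (1 - s) *\<^sub>R (x - \<theta>0)"
    by (simp add: algebra_simps)
  have "lr_norm r (x - (\<theta>0 + s *\<^sub>R (\<theta> - \<theta>0))) \<le> s * lr_norm r (x - \<theta>) + (1 - s) * lr_norm r (x - \<theta>0)"
    unfolding eq using lr_norm_triangle[OF r, of "s *\<^sub>R (x - \<theta>)" "(1 - s) *\<^sub>R (x - \<theta>0)"] r s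
    by (simp add: lr_norm_scaleR)
  moreover have "u \<bullet> (x - (\<theta>0 + s *\<^sub>R (\<theta> - \<theta>0))) = s * (u \<bullet> (x - \<theta>)) + (1 - s) * (u \<bullet> (x - \<theta>0))"
    unfolding eq by (simp add: inner_add_right)
  ultimately show ?thesis by (simp add: loss_def Phi_def algebra_simps)
qed

lemma loss_excess_le:
  fixes \<theta> :: "real ^ 'n"
  assumes "1 < r"
  shows "loss r u \<theta> x - loss r u \<theta>0 x \<le> (CARD('n) + norm u) * norm (\<theta> - \<theta>0)"
proof -
  have "\<bar>u \<bullet> (\<theta>0 - \<theta>)\<bar> \<le> norm u * norm (\<theta>0 - \<theta>)" by (rule Cauchy_Schwarz_ineq2)
  then show ?thesis
    using abs_Phi_diff_le[OF assms, of u "x - \<theta>" "x - \<theta>0"] lr_norm_le_norm[OF assms, of "\<theta>0 - \<theta>"]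
    by (simp add: loss_def distrib_right norm_minus_commute)
qed

text \<open>By Hoelder's inequality \<open>lr_norm q u < 1\<close> lets the norm dominate the linear
  term. Nonnegative loss makes the Gibbs weights at most 1 and thus integrable.\<close>

lemma loss_nonneg:
  assumes "1 < r" "1 / r + 1 / q = 1" "lr_norm q u < 1"
  shows "0 \<le> loss r u \<theta> x"
proof -
  have "\<bar>u \<bullet> (x - \<theta>)\<bar> \<le> lr_norm q u * lr_norm r (x - \<theta>)"
    by (rule lr_norm_Holder) fact+
  also have "\<dots> \<le> 1 * lr_norm r (x - \<theta>)"
    using assms by (intro mult_right_mono lr_norm_nonneg) simp
  finally show ?thesis by (simp add: loss_def Phi_def)
qed

section \<open>Scaling, Lipschitz and growth properties of the excess risk summed over the
  sample\<close>

definition excess :: "real \<Rightarrow> real ^ 'n \<Rightarrow> real ^ 'n \<Rightarrow> nat \<Rightarrow> (nat \<Rightarrow> real ^ 'n) \<Rightarrow> real ^ 'n \<Rightarrow> real" where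
  "excess r u \<theta>0 n x \<theta> = (\<Sum>i=1..n. loss r u \<theta> (x i) - loss r u \<theta>0 (x i))"

lemma excess_eq_emp_risk:
  assumes "1 \<le> n"
  shows "excess r u \<theta>0 n x \<theta> = real n * (emp_risk r u n x \<theta> - emp_risk r u n x \<theta>0)"
  using assms by (simp add: excess_def emp_risk_def sum_subtractf algebra_simps)

lemma excess_measurable [measurable]: "excess r u \<theta>0 n x \<in> borel_measurable borel"
  unfolding excess_def [abs_def] loss_def by measurable

lemma excess_scaled_le:
  assumes "1 < r" "0 \<le> s" "s \<le> 1"
  shows "excess r u \<theta>0 n x (\<theta>0 + s *\<^sub>R (\<theta> - \<theta>0)) \<le> s * excess r u \<theta>0 n x \<theta>"
  unfolding excess_def sum_distrib_left by (intro sum_mono loss_excess_scaled_le assms)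

lemma excess_le:
  fixes \<theta> :: "real ^ 'n"
  assumes "1 < r"
  shows "excess r u \<theta>0 n x \<theta> \<le> real n * ((CARD('n) + norm u) * norm (\<theta> - \<theta>0))"
proof -
  have "excess r u \<theta>0 n x \<theta> \<le> (\<Sum>i=1..n. (CARD('n) + norm u) * norm (\<theta> - \<theta>0))"
    unfolding excess_def by (intro sum_mono loss_excess_le assms)
  then show ?thesis by simp
qed

text \<open>A deterministic statement about one sample. On the sphere of radius
  \<open>L / sqrt n\<close> the linear term costs at most \<open>CARD('n) * k * L\<close>, whereas
  the sample points in one ball contribute at least \<open>c * \<beta> * L * L\<close>; the
  condition on \<open>L\<close> leaves at least \<open>L\<close>. Convexity carries the bound
  outwards.\<close>

lemma excess_linear_growth:
  fixes u \<theta>0 :: "real ^ 'n" and k \<beta> L :: real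
  assumes r: "1 < r" and e: "0 < e" and c: "0 < c"
    and balls: "\<And>d. norm d \<le> e \<Longrightarrow> \<exists>y\<in>{y1, y2}. \<forall>t\<in>cball y e.
       lr_norm r t + lr_grad r t \<bullet> d + c * (norm d)\<^sup>2 \<le> lr_norm r (t + d)"
    and grad: "\<And>j. \<bar>\<Sum>i=1..n. (lr_grad r (x i - \<theta>0) + u) $ j\<bar> \<le> k * sqrt n"
    and count: "\<And>y. y \<in> {y1, y2} \<Longrightarrow> \<beta> * real n \<le> (\<Sum>i=1..n. indicator (cball y e) (x i - \<theta>0))"
    and L: "0 < L" "CARD('n) * k + 1 \<le> c * \<beta> * L" and n: "1 \<le> n" "L \<le> e * sqrt n"
    and \<theta>: "L \<le> sqrt n * norm (\<theta> - \<theta>0)"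
  shows "sqrt n * norm (\<theta> - \<theta>0) \<le> excess r u \<theta>0 n x \<theta>"
proof -
  have on_sphere: "L \<le> excess r u \<theta>0 n x \<theta>" if \<theta>: "sqrt n * norm (\<theta> - \<theta>0) = L" for \<theta>
  proof -
    define d where "d = \<theta> - \<theta>0"
    have nd: "sqrt n * norm (- d) = L" using \<theta> by (simp add: d_def norm_minus_commute)
    have "norm (- d) \<le> e"
    proof -
      have "sqrt n * norm (- d) \<le> sqrt n * e" using nd n by (simp add: mult.commute)
      then show ?thesis using n by simp
    qed
    then obtain y where y: "y \<in> {y1, y2}" "\<And>t. t \<in> cball y e \<Longrightarrow>
       lr_norm r t + lr_grad r t \<bullet> (- d) + c * (norm (- d))\<^sup>2 \<le> lr_norm r (t + - d)"
      using balls by meson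
    \<comment> \<open>Observations in the chosen ball obey the strict inequality, all others the
      plain subgradient inequality. The increment is \<open>- d\<close> because moving the parameter
      by \<open>d\<close> moves \<open>x i - \<theta>0\<close> by \<open>- d\<close>.\<close>
    have pt: "c * (norm d)\<^sup>2 * indicator (cball y e) (x i - \<theta>0) - (lr_grad r (x i - \<theta>0) + u) \<bullet> d
        \<le> loss r u \<theta> (x i) - loss r u \<theta>0 (x i)" for i
    proof -
      have eq: "x i - \<theta> = (x i - \<theta>0) + - d" by (simp add: d_def)
      show ?thesis
        using y(2)[of "x i - \<theta>0"] lr_norm_subgradient[OF r, of "x i - \<theta>0" "- d"]
        unfolding loss_def Phi_def eq by (auto simp: inner_add_left inner_add_right inner_diff_right split: split_indicator)
    qed
    have *: "\<bar>(\<Sum>i=1..n. lr_grad r (x i - \<theta>0) + u) \<bullet> d\<bar> \<le> (\<Sum>j\<in>(UNIV :: 'n set). (k * sqrt n) * norm d)"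
      unfolding inner_vec_def
    proof (rule order_trans[OF sum_abs], rule sum_mono)
      fix j
      show "\<bar>(\<Sum>i=1..n. lr_grad r (x i - \<theta>0) + u) $ j \<bullet> d $ j\<bar> \<le> (k * sqrt n) * norm d"
        using grad[of j] component_le_norm_cart[of d j] by (auto simp: abs_mult intro!: mult_mono)
    qed
    have lin: "(\<Sum>i=1..n. (lr_grad r (x i - \<theta>0) + u) \<bullet> d) \<le> CARD('n) * k * L"
    proof -
      have "(\<Sum>j\<in>(UNIV :: 'n set). (k * sqrt n) * norm d) = CARD('n) * k * (sqrt n * norm (- d))"
        by simp
      then show ?thesis using * unfolding nd inner_sum_left by linarith
    qed
    have "L\<^sup>2 = real n * (norm d)\<^sup>2"
      unfolding nd[symmetric] by (simp add: power_mult_distrib)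
    then have "c * \<beta> * L * L = c * (norm d)\<^sup>2 * (\<beta> * real n)"
      by (simp add: power2_eq_square)
    also have "\<dots> \<le> c * (norm d)\<^sup>2 * (\<Sum>i=1..n. indicator (cball y e) (x i - \<theta>0))"
      using c count[OF y(1)] by (intro mult_left_mono) auto
    finally have quad: "c * \<beta> * L * L \<le> c * (norm d)\<^sup>2 * (\<Sum>i=1..n. indicator (cball y e) (x i - \<theta>0))" .
    have "(CARD('n) * k + 1) * L \<le> c * \<beta> * L * L" using L by (intro mult_right_mono) auto
    then have "L \<le> c * \<beta> * L * L - CARD('n) * k * L" by (simp add: algebra_simps)
    also have "\<dots> \<le> (\<Sum>i=1..n. c * (norm d)\<^sup>2 * indicator (cball y e) (x i - \<theta>0) - (lr_grad r (x i - \<theta>0) + u) \<bullet> d)"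
      using lin quad by (simp add: sum_subtractf sum_distrib_left)
    also have "\<dots> \<le> excess r u \<theta>0 n x \<theta>"
      unfolding excess_def by (intro sum_mono pt)
    finally show ?thesis .
  qed
  \<comment> \<open>The factor by which \<open>\<theta>\<close> is pulled towards
    \<open>\<theta>0\<close> to land on that sphere.\<close>
  define s where "s = L / (sqrt n * norm (\<theta> - \<theta>0))"
  have pos: "0 < sqrt n * norm (\<theta> - \<theta>0)" using L \<theta> by linarith
  have s: "0 < s" "s \<le> 1" using L \<theta> pos by (auto simp: s_def)
  have "sqrt n * norm (\<theta>0 + s *\<^sub>R (\<theta> - \<theta>0) - \<theta>0) = s * (sqrt n * norm (\<theta> - \<theta>0))"
    using s by simp
  also have "\<dots> = L"
  proof -
    have "L / D * D = L" if "0 < D" for D :: real using that by simp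
    then show ?thesis unfolding s_def using pos .
  qed
  finally have "L \<le> excess r u \<theta>0 n x (\<theta>0 + s *\<^sub>R (\<theta> - \<theta>0))" by (rule on_sphere)
  also have "\<dots> \<le> s * excess r u \<theta>0 n x \<theta>"
    using s by (intro excess_scaled_le r) auto
  finally have "L \<le> s * excess r u \<theta>0 n x \<theta>" .
  then have "L / s \<le> excess r u \<theta>0 n x \<theta>" using s by (simp add: field_simps)
  moreover have "L / s = sqrt n * norm (\<theta> - \<theta>0)" using L by (simp add: s_def)
  ultimately show ?thesis by simp
qed

section \<open>From growth of the excess risk to a posterior tail bound\<close>

lemma gibbs_weight_integrable:
  assumes r: "1 < r" "1 / r + 1 / q = 1" "lr_norm q u < 1" and \<omega>: "0 < \<omega>"
    and Q: "prob_space Q" "sets Q = sets borel"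
  shows "integrable Q (\<lambda>\<theta>. exp (- \<omega> * real n * emp_risk r u n x \<theta>))"
proof -
  interpret Q: prob_space Q by fact
  note [measurable_cong] = Q(2)
  have "0 \<le> emp_risk r u n x \<theta>" for \<theta>
    unfolding emp_risk_def using loss_nonneg[OF r] by (intro mult_nonneg_nonneg sum_nonneg) auto
  then show ?thesis
    using \<omega> by (intro Q.integrable_const_bound[where B = 1]) auto
qed

text \<open>The tail is split at radius \<open>\<rho>\<close>. Inside, \<open>F\<close> is at least
  \<open>\<omega> * a\<close> and the contraction argument applies; outside, \<open>F\<close> is at
  least \<open>\<omega> * sqrt n * \<rho>\<close> and the crude argument with a ball of radius
  \<open>\<eta>\<close> suffices.\<close>

lemma gibbs_posterior_tail_le:
  fixes u \<theta>0 :: "real ^ 'n"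
  assumes r: "1 < r" "1 / r + 1 / q = 1" "lr_norm q u < 1" and \<omega>: "0 < \<omega>" and n: "1 \<le> n"
    and Q: "has_lebesgue_density Q \<pi>" "prob_space Q"
    and \<pi>: "\<And>\<theta>. \<theta> \<in> cball \<theta>0 \<rho> \<Longrightarrow> c \<le> \<pi> \<theta>" "\<And>\<theta>. \<theta> \<in> cball \<theta>0 \<rho> \<Longrightarrow> \<pi> \<theta> \<le> C"
    and c: "0 < c" and \<eta>: "0 < \<eta>" "\<eta> \<le> \<rho>" "\<omega> * (real n * ((CARD('n) + norm u) * \<eta>)) \<le> 1"
    and growth: "\<And>\<theta>. a \<le> sqrt n * norm (\<theta> - \<theta>0) \<Longrightarrow> sqrt n * norm (\<theta> - \<theta>0) \<le> excess r u \<theta>0 n x \<theta>"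
    and a: "0 \<le> a" "a \<le> sqrt n * \<rho>"
  shows "measure (gibbs_posterior r u \<omega> Q n x) {\<theta>. norm (\<theta> - \<theta>0) > a * real n powr (- 1 / 2)}
    \<le> C / c * 2 ^ CARD('n) * exp (- (\<omega> * a) / 2)
      + exp (1 - \<omega> * (sqrt n * \<rho>)) / (c * measure lborel (cball \<theta>0 \<eta>))"
proof -
  interpret Q: prob_space Q by fact
  have sets_Q [measurable_cong]: "sets Q = sets borel" using Q by (auto simp: has_lebesgue_density_def)
  have \<rho>: "0 < \<rho>" using \<eta> by simp
  have C: "0 \<le> C" using \<pi>[of \<theta>0] c \<rho> by (meson centre_in_cball less_imp_le order_trans)
  define F where "F = (\<lambda>\<theta>. \<omega> * excess r u \<theta>0 n x \<theta>)"
  have [measurable]: "F \<in> borel_measurable borel" by (simp add: F_def)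
  define N where "N = {\<theta>. a < sqrt n * norm (\<theta> - \<theta>0)} \<inter> cball \<theta>0 \<rho>"
  define D where "D = - cball \<theta>0 \<rho>"
  have [measurable]: "N \<in> sets borel" "D \<in> sets borel" by (simp_all add: N_def D_def)
  have tail: "{\<theta>. norm (\<theta> - \<theta>0) > a * real n powr (- 1 / 2)} \<subseteq> N \<union> D" (is "?T \<subseteq> _")
  proof
    fix \<theta> assume "\<theta> \<in> ?T"
    moreover have "real n powr (- 1 / 2) = 1 / sqrt n"
      using n by (simp add: powr_minus_divide powr_half_sqrt[symmetric])
    ultimately have "a < sqrt n * norm (\<theta> - \<theta>0)"
      using n by (simp add: pos_divide_less_eq mult.commute)
    then show "\<theta> \<in> N \<union> D" by (auto simp: N_def D_def)
  qed
  have [measurable]: "?T \<in> sets borel" by measurable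
  have F_growth: "\<omega> * (sqrt n * norm (\<theta> - \<theta>0)) \<le> F \<theta>" if "a \<le> sqrt n * norm (\<theta> - \<theta>0)" for \<theta>
    using growth[OF that] \<omega> by (simp add: F_def)
  define J where "J = (\<lambda>A. \<integral>\<^sup>+\<theta>. indicator A \<theta> * ennreal (exp (- F \<theta>)) \<partial>Q)"
  define Z where "Z = (\<integral>\<^sup>+\<theta>. ennreal (exp (- F \<theta>)) \<partial>Q)"
  define \<kappa>1 where "\<kappa>1 = C / c * 2 ^ CARD('n) * exp (- (\<omega> * a) / 2)"
  define \<kappa>2 where "\<kappa>2 = exp (1 - \<omega> * (sqrt n * \<rho>)) / (c * measure lborel (cball \<theta>0 \<eta>))"
  have \<kappa>: "0 \<le> \<kappa>1" "0 \<le> \<kappa>2" using C c by (simp_all add: \<kappa>1_def \<kappa>2_def)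
  have "J N \<le> ennreal \<kappa>1 * Z"
    unfolding J_def Z_def \<kappa>1_def
  proof (rule posterior_near_tail_bound[OF _ _ Q(1) \<pi> c])
    show "F (\<theta>0 + (1 / 2) *\<^sub>R (\<theta> - \<theta>0)) \<le> F \<theta> / 2" for \<theta>
      using excess_scaled_le[OF r(1), of "1 / 2" u \<theta>0 n x \<theta>] \<omega> by (simp add: F_def)
    show "\<omega> * a \<le> F \<theta>" if "\<theta> \<in> N" for \<theta>
    proof -
      have "\<omega> * a \<le> \<omega> * (sqrt n * norm (\<theta> - \<theta>0))" using that \<omega> by (simp add: N_def)
      then show ?thesis using F_growth[of \<theta>] that by (simp add: N_def)
    qed
  qed (auto simp: N_def)
  moreover have "J D \<le> ennreal \<kappa>2 * Z"
    unfolding J_def Z_def \<kappa>2_def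
  proof (rule posterior_far_tail_bound[OF _ Q _ c \<eta>(1)])
    show "c \<le> \<pi> \<theta>" if "\<theta> \<in> cball \<theta>0 \<eta>" for \<theta> using that \<eta> \<pi> by simp
    show "F \<theta> \<le> 1" if "\<theta> \<in> cball \<theta>0 \<eta>" for \<theta>
    proof -
      have "F \<theta> \<le> \<omega> * (real n * ((CARD('n) + norm u) * norm (\<theta> - \<theta>0)))"
        using excess_le[OF r(1), of u \<theta>0 n x \<theta>] \<omega> by (simp add: F_def)
      also have "\<dots> \<le> \<omega> * (real n * ((CARD('n) + norm u) * \<eta>))"
        using that \<omega> by (intro mult_left_mono) (auto simp: dist_norm norm_minus_commute)
      finally show ?thesis using \<eta> by simp
    qed
    show "\<omega> * (sqrt n * \<rho>) \<le> F \<theta>" if "\<theta> \<in> D" for \<theta>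
    proof -
      have \<theta>: "sqrt n * \<rho> \<le> sqrt n * norm (\<theta> - \<theta>0)"
        using that by (intro mult_left_mono) (auto simp: D_def dist_norm norm_minus_commute)
      then have "\<omega> * (sqrt n * \<rho>) \<le> \<omega> * (sqrt n * norm (\<theta> - \<theta>0))" using \<omega> by simp
      then show ?thesis using F_growth[of \<theta>] \<theta> a by simp
    qed
  qed auto
  moreover have "J ?T \<le> J N + J D"
  proof -
    have "J ?T \<le> (\<integral>\<^sup>+\<theta>. indicator N \<theta> * ennreal (exp (- F \<theta>)) + indicator D \<theta> * ennreal (exp (- F \<theta>)) \<partial>Q)"
      unfolding J_def using tail by (intro nn_integral_mono) (auto split: split_indicator)
    also have "\<dots> = J N + J D" unfolding J_def by (rule nn_integral_add) measurable
    finally show ?thesis .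
  qed
  ultimately have J: "J ?T \<le> ennreal (\<kappa>1 + \<kappa>2) * Z"
    using \<kappa> by (simp add: distrib_right) (meson add_mono order_trans)
  define w where "w = (\<lambda>\<theta>. exp (- \<omega> * real n * emp_risk r u n x \<theta>))"
  have w [measurable]: "w \<in> borel_measurable borel" by (simp add: w_def)
  \<comment> \<open>The Gibbs weights are \<open>exp (- F)\<close> up to the constant weight at
    \<open>\<theta>0\<close>, which cancels in the posterior ratio.\<close>
  define k where "k = w \<theta>0"
  have w_eq: "w \<theta> = k * exp (- F \<theta>)" for \<theta>
    using n by (simp add: w_def k_def F_def excess_eq_emp_risk flip: exp_add) (simp add: algebra_simps)
  have k: "0 < k" by (simp add: k_def w_def)
  have int: "integrable Q w"
    unfolding w_def by (rule gibbs_weight_integrable[OF r \<omega> Q(2) sets_Q])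
  have Z_nonneg: "0 \<le> (\<integral>\<theta>. w \<theta> \<partial>Q)" by (simp add: w_def)
  have intT: "integrable Q (\<lambda>\<theta>. indicator ?T \<theta> *\<^sub>R w \<theta>)"
    using int by (rule integrable_mult_indicator[rotated]) measurable
  have "ennreal (LINT \<theta>:?T|Q. w \<theta>) = (\<integral>\<^sup>+\<theta>. ennreal (indicator ?T \<theta> *\<^sub>R w \<theta>) \<partial>Q)"
    unfolding set_lebesgue_integral_def by (rule nn_integral_eq_integral[symmetric, OF intT]) (simp add: w_def)
  also have "\<dots> = (\<integral>\<^sup>+\<theta>. ennreal k * (indicator ?T \<theta> * ennreal (exp (- F \<theta>))) \<partial>Q)"
    using k by (intro nn_integral_cong) (auto simp: w_eq ennreal_mult' split: split_indicator)
  also have "\<dots> = ennreal k * J ?T"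
    unfolding J_def by (rule nn_integral_cmult) measurable
  also have "\<dots> \<le> ennreal k * (ennreal (\<kappa>1 + \<kappa>2) * Z)"
    by (intro mult_left_mono J) simp
  also have "\<dots> = ennreal (\<kappa>1 + \<kappa>2) * (ennreal k * Z)" by (simp add: mult_ac)
  also have "ennreal k * Z = (\<integral>\<^sup>+\<theta>. ennreal (w \<theta>) \<partial>Q)"
    unfolding Z_def using k by (subst nn_integral_cmult[symmetric]) (auto simp: w_eq ennreal_mult')
  also have "\<dots> = ennreal (\<integral>\<theta>. w \<theta> \<partial>Q)"
    by (rule nn_integral_eq_integral[OF int]) (simp add: w_def)
  finally have le: "(LINT \<theta>:?T|Q. w \<theta>) \<le> (\<kappa>1 + \<kappa>2) * (\<integral>\<theta>. w \<theta> \<partial>Q)"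
    using \<kappa> Z_nonneg by (subst (asm) ennreal_mult'[symmetric]) (auto simp: ennreal_le_iff)
  \<comment> \<open>In the case of a zero denominator the quotient is 0 by the convention for
    division, and the bound is nonnegative.\<close>
  have "(LINT \<theta>:?T|Q. w \<theta>) / (\<integral>\<theta>. w \<theta> \<partial>Q) \<le> \<kappa>1 + \<kappa>2"
    using le \<kappa> Z_nonneg by (cases "(\<integral>\<theta>. w \<theta> \<partial>Q) = 0") (auto simp: pos_divide_le_eq)
  then show ?thesis
    using measure_gibbs_posterior[OF Q(2) sets_Q int[unfolded w_def], of ?T]
    unfolding w_def \<kappa>1_def \<kappa>2_def by simp
qed

subsection \<open>Concentration\<close>

text \<open>A non-integrable \<open>f\<close> has integral 0, so measurability of the posterior probability as a
  function of the sample never has to be shown.\<close>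

lemma integral_joint_law_le:
  fixes f :: "(nat \<Rightarrow> real ^ 'n) \<Rightarrow> real"
  assumes M: "prob_space M" and X: "\<And>i. 1 \<le> i \<Longrightarrow> X i \<in> borel_measurable M"
    and B: "B \<in> sets M" and f: "\<And>x. f x \<le> 1" and \<kappa>: "0 \<le> \<kappa>"
    and good: "\<And>w. w \<in> space M - B \<Longrightarrow> f (\<lambda>i\<in>{1..n}. X i w) \<le> \<kappa>"
  shows "(\<integral>x. f x \<partial>joint_law M X n) \<le> measure M B + \<kappa>"
proof (cases "integrable (joint_law M X n) f")
  case False
  then show ?thesis using \<kappa> by (simp add: not_integrable_integral_eq add_nonneg_nonneg)
next
  case True
  interpret prob_space M by fact
  let ?T = "\<lambda>w. \<lambda>i\<in>{1..n}. X i w"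
  have T: "?T \<in> measurable M (Pi\<^sub>M {1..n} (\<lambda>_. borel))"
    using X by (intro measurable_restrict) auto
  have f_meas: "f \<in> borel_measurable (Pi\<^sub>M {1..n} (\<lambda>_. borel))"
    using borel_measurable_integrable[OF True] by (simp add: joint_law_def)
  have "integrable M (\<lambda>w. f (?T w))"
    using True integrable_distr_eq[OF T f_meas] by (simp add: joint_law_def)
  moreover have "integrable M (\<lambda>w. indicator B w + \<kappa>)"
    using B by (intro Bochner_Integration.integrable_add) (auto simp: emeasure_eq_measure)
  ultimately have "(\<integral>w. f (?T w) \<partial>M) \<le> (\<integral>w. indicator B w + \<kappa> \<partial>M)"
  proof (rule integral_mono)
    fix w assume "w \<in> space M"
    then show "f (?T w) \<le> indicator B w + \<kappa>"
      using good[of w] f[of "?T w"] \<kappa> by (cases "w \<in> B") auto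
  qed
  also have "\<dots> = measure M B + \<kappa>"
    using B by (subst Bochner_Integration.integral_add) (auto simp: emeasure_eq_measure prob_space)
  finally show ?thesis
    using integral_distr[OF T f_meas] by (simp add: joint_law_def)
qed

lemma measure_density_cball_pos:
  fixes y :: "real ^ 'n"
  assumes "prob_space P" and p: "has_lebesgue_density P p" and c: "0 < c" "\<And>x. x \<in> cball y e \<Longrightarrow> c \<le> p x" and e: "0 < e"
  shows "0 < measure P (cball y e)"
proof -
  interpret prob_space P by fact
  have [measurable]: "p \<in> borel_measurable borel" and P: "P = density lborel (\<lambda>x. ennreal (p x))"
    using p by (auto simp: has_lebesgue_density_def)
  have "0 < measure lborel (cball y e)" using e by (rule content_cball_pos)
  then have "0 < emeasure lborel (cball y e)"
    by (simp add: measure_def enn2real_positive_iff)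
  then have "0 < (\<integral>\<^sup>+x. ennreal c * indicator (cball y e) x \<partial>lborel)"
    using c by (simp add: nn_integral_cmult_indicator ennreal_zero_less_mult_iff)
  also have "\<dots> \<le> (\<integral>\<^sup>+x. ennreal (p x) * indicator (cball y e) x \<partial>lborel)"
    using c by (intro nn_integral_mono) (auto split: split_indicator intro: ennreal_leI)
  also have "\<dots> = emeasure P (cball y e)" by (simp add: P emeasure_density)
  finally show ?thesis by (simp add: emeasure_eq_measure)
qed

text \<open>With \<open>t = b * sqrt n\<close> the expression is a constant times
  \<open>t ^ (2 * d) / exp t\<close>.\<close>

lemma power_mult_exp_minus_sqrt_tendsto_0:
  assumes "0 < b"
  shows "(\<lambda>n. real n ^ d * exp (- (b * sqrt n))) \<longlonglongrightarrow> 0"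
proof -
  have "filterlim (\<lambda>n. b * sqrt (real n)) at_top sequentially"
    using assms by (intro filterlim_tendsto_pos_mult_at_top[OF tendsto_const] filterlim_compose[OF sqrt_at_top filterlim_real_sequentially])
  from filterlim_compose[OF tendsto_power_div_exp_0[of "2 * d"] this]
  have "(\<lambda>n. 1 / b ^ (2 * d) * ((b * sqrt n) ^ (2 * d) / exp (b * sqrt n))) \<longlonglongrightarrow> 1 / b ^ (2 * d) * 0"
    by (intro tendsto_mult_left)
  moreover have "1 / b ^ (2 * d) * ((b * sqrt n) ^ (2 * d) / exp (b * sqrt n)) = real n ^ d * exp (- (b * sqrt n))" for n
  proof -
    have "(b * sqrt n) ^ (2 * d) = b ^ (2 * d) * real n ^ d"
      unfolding power_mult_distrib by (simp add: power_mult)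
    then show ?thesis using assms by (simp add: exp_minus field_simps)
  qed
  ultimately show ?thesis by simp
qed

text \<open>The radius \<open>\<eta> / n\<close> compensates for the factor \<open>n\<close> in the
  Lipschitz bound of the excess. Its price is a volume of order \<open>n\<close> to the power minus
  \<open>CARD('n)\<close>, which \<open>exp (- \<omega> * \<rho> * sqrt n)\<close>
  outweighs.\<close>

lemma posterior_bound_tendsto_0:
  fixes \<theta>0 :: "real ^ 'n"
  assumes a: "filterlim a at_top sequentially" and \<omega>: "0 < \<omega>" and \<rho>: "0 < \<rho>" and c: "0 < c" and \<eta>: "0 < \<eta>"
  shows "(\<lambda>n. C / c * 2 ^ CARD('n) * exp (- (\<omega> * a n) / 2)
      + exp (1 - \<omega> * (sqrt n * \<rho>)) / (c * measure lborel (cball \<theta>0 (\<eta> / real n)))) \<longlonglongrightarrow> 0"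
proof -
  let ?d = "CARD('n)"
  define v where "v = unit_ball_vol (real ?d)"
  have v: "0 < v" by (simp add: v_def)
  have "filterlim (\<lambda>n. \<omega> / 2 * a n) at_top sequentially"
    using \<omega> by (intro filterlim_tendsto_pos_mult_at_top[OF tendsto_const] a) auto
  then have "filterlim (\<lambda>n. - (\<omega> * a n) / 2) at_bot sequentially"
    by (simp add: filterlim_uminus_at_bot)
  from filterlim_compose[OF exp_at_bot this]
  have "(\<lambda>n. C / c * 2 ^ ?d * exp (- (\<omega> * a n) / 2)) \<longlonglongrightarrow> C / c * 2 ^ ?d * 0"
    by (intro tendsto_mult_left)
  moreover have "(\<lambda>n. exp 1 / (c * v * \<eta> ^ ?d) * (real n ^ ?d * exp (- ((\<omega> * \<rho>) * sqrt n)))) \<longlonglongrightarrow> exp 1 / (c * v * \<eta> ^ ?d) * 0"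
    using \<omega> \<rho> by (intro tendsto_mult_left power_mult_exp_minus_sqrt_tendsto_0) simp
  \<comment> \<open>For \<open>n = 0\<close> both sides are 0, by the conventions for division by
    0.\<close>
  moreover have "exp 1 / (c * v * \<eta> ^ ?d) * (real n ^ ?d * exp (- ((\<omega> * \<rho>) * sqrt n)))
      = exp (1 - \<omega> * (sqrt n * \<rho>)) / (c * measure lborel (cball \<theta>0 (\<eta> / real n)))" for n
  proof -
    have "measure lborel (cball \<theta>0 (\<eta> / real n)) = v * (\<eta> ^ ?d / real n ^ ?d)"
      using \<eta> by (simp add: content_cball v_def power_divide)
    moreover have "exp (1 - \<omega> * (sqrt n * \<rho>)) = exp 1 * exp (- ((\<omega> * \<rho>) * sqrt n))"
      by (simp add: mult_ac flip: exp_add)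
    ultimately show ?thesis by (simp add: mult_ac)
  qed
  ultimately show ?thesis
    using tendsto_add[of _ "C / c * 2 ^ ?d * 0" sequentially _ "exp 1 / (c * v * \<eta> ^ ?d) * 0"] by simp
qed

text \<open>A union bound over one Hoeffding event per gradient coordinate and one per ball. The
  gradient events have deviation \<open>k * sqrt n\<close>, so their probability is made small
  through \<open>k\<close> rather than \<open>n\<close>; the counts have deviation
  \<open>\<beta> * n\<close> and fail with exponentially small probability.\<close>

lemma bad_event_probability_le:
  fixes u \<theta>0 y1 y2 :: "real ^ 'n" and k \<beta> :: real
  assumes M: "prob_space M" and X: "prob_space.indep_vars M (\<lambda>_. borel) X {1..}"
    and XP: "\<forall>i\<ge>1. distr M borel (X i) = P"
    and r: "1 < r" and sets_P: "sets P = sets borel"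
    and mean: "\<And>j. (\<integral>x. (lr_grad r (x - \<theta>0) + u) $ j \<partial>P) = 0"
    and balls: "\<And>y. y \<in> {y1, y2} \<Longrightarrow> 2 * \<beta> \<le> measure P (cball (\<theta>0 + y) e)"
    and k: "0 \<le> k" and \<beta>: "0 \<le> \<beta>" and n: "1 \<le> n"
  obtains B where "B \<in> sets M"
    "measure M B \<le> 2 * CARD('n) * exp (- k\<^sup>2 / (2 * (1 + norm u)\<^sup>2)) + 4 * exp (- (\<beta>\<^sup>2 / 2) * real n)"
    "\<And>w j. w \<in> space M - B \<Longrightarrow> \<bar>\<Sum>i=1..n. (lr_grad r (X i w - \<theta>0) + u) $ j\<bar> \<le> k * sqrt n"
    "\<And>w y. w \<in> space M - B \<Longrightarrow> y \<in> {y1, y2} \<Longrightarrow> \<beta> * real n \<le> (\<Sum>i=1..n. indicator (cball y e) (X i w - \<theta>0))"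
proof -
  interpret prob_space M by fact
  have X_meas [measurable]: "X i \<in> borel_measurable M" if "1 \<le> i" for i
    using X that unfolding indep_vars_def by auto
  define g where "g = (\<lambda>j x. (lr_grad r (x - \<theta>0) + u) $ j)"
  define b where "b = (\<lambda>y x. indicator (cball y e) (x - \<theta>0) :: real)"
  have b_eq: "b y = indicator (cball (\<theta>0 + y) e)" for y
    by (auto simp: b_def dist_norm algebra_simps fun_eq_iff split: split_indicator)
  have [measurable]: "g j \<in> borel_measurable borel" for j
    unfolding g_def cart_eq_inner_axis by measurable
  have [measurable]: "b y \<in> borel_measurable borel" for y
    unfolding b_eq by (intro borel_measurable_indicator) simp
  define Bg where "Bg = (\<lambda>j. {w \<in> space M. k * sqrt n \<le> \<bar>(\<Sum>i=1..n. g j (X i w)) - real n * (\<integral>x. g j x \<partial>P)\<bar>})"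
  define Bb where "Bb = (\<lambda>y. {w \<in> space M. \<beta> * real n \<le> \<bar>(\<Sum>i=1..n. b y (X i w)) - real n * (\<integral>x. b y x \<partial>P)\<bar>})"
  have [measurable]: "(\<lambda>w. \<Sum>i=1..n. g j (X i w)) \<in> borel_measurable M" "(\<lambda>w. \<Sum>i=1..n. b y (X i w)) \<in> borel_measurable M" for j y
    by (auto intro!: borel_measurable_sum measurable_compose[OF X_meas])
  have B_sets: "Bg j \<in> sets M" "Bb y \<in> sets M" for j y
    unfolding Bg_def Bb_def by measurable
  have Bg: "measure M (Bg j) \<le> 2 * exp (- k\<^sup>2 / (2 * (1 + norm u)\<^sup>2))" for j
  proof -
    have "\<bar>g j x\<bar> \<le> 1 + norm u" for x
      using abs_lr_grad_le_1[OF r, of "x - \<theta>0" j] component_le_norm_cart[of u j]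
      by (auto simp: g_def intro: order_trans[OF abs_triangle_ineq])
    moreover have "0 < 1 + norm u" by (simp add: add_pos_nonneg)
    ultimately have "measure M (Bg j) \<le> 2 * exp (- (k * sqrt n)\<^sup>2 / (2 * real n * (1 + norm u)\<^sup>2))"
      unfolding Bg_def using k n by (intro iid_sum_deviation[OF M X XP]) auto
    also have "(k * sqrt n)\<^sup>2 = real n * k\<^sup>2" by (simp add: power_mult_distrib)
    finally show ?thesis using n by simp
  qed
  have Bb: "measure M (Bb y) \<le> 2 * exp (- (\<beta>\<^sup>2 / 2) * real n)" for y
  proof -
    have "\<bar>b y x\<bar> \<le> 1" for x by (simp add: b_def)
    then have "measure M (Bb y) \<le> 2 * exp (- (\<beta> * real n)\<^sup>2 / (2 * real n * 1\<^sup>2))"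
      unfolding Bb_def using \<beta> n by (intro iid_sum_deviation[OF M X XP]) auto
    also have "- (\<beta> * real n)\<^sup>2 / (2 * real n * 1\<^sup>2) = - (\<beta>\<^sup>2 / 2) * real n"
      using n by (simp add: power2_eq_square)
    finally show ?thesis .
  qed
  define B where "B = (\<Union>j. Bg j) \<union> (Bb y1 \<union> Bb y2)"
  show ?thesis
  proof (rule that[of B])
    show "B \<in> sets M" unfolding B_def using B_sets by auto
    have "measure M (\<Union>j. Bg j) \<le> (\<Sum>j\<in>UNIV. measure M (Bg j))"
      using B_sets by (intro measure_UNION_le) auto
    also have "\<dots> \<le> (\<Sum>j\<in>(UNIV :: 'n set). 2 * exp (- k\<^sup>2 / (2 * (1 + norm u)\<^sup>2)))"
      by (intro sum_mono Bg)
    finally have "measure M (\<Union>j. Bg j) \<le> 2 * CARD('n) * exp (- k\<^sup>2 / (2 * (1 + norm u)\<^sup>2))" by simp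
    moreover have "measure M B \<le> measure M (\<Union>j. Bg j) + measure M (Bb y1 \<union> Bb y2)"
      unfolding B_def using B_sets by (intro measure_Un_le) auto
    moreover have "measure M (Bb y1 \<union> Bb y2) \<le> measure M (Bb y1) + measure M (Bb y2)"
      using B_sets by (intro measure_Un_le) auto
    ultimately show "measure M B \<le> 2 * CARD('n) * exp (- k\<^sup>2 / (2 * (1 + norm u)\<^sup>2)) + 4 * exp (- (\<beta>\<^sup>2 / 2) * real n)"
      using Bb[of y1] Bb[of y2] by linarith
  next
    fix w j assume w: "w \<in> space M - B"
    then have "w \<notin> Bg j" by (auto simp: B_def)
    then show "\<bar>\<Sum>i=1..n. (lr_grad r (X i w - \<theta>0) + u) $ j\<bar> \<le> k * sqrt n"
      using w mean[of j] unfolding Bg_def g_def by auto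
  next
    fix w y assume w: "w \<in> space M - B" and y: "y \<in> {y1, y2}"
    then have "w \<notin> Bb y" by (auto simp: B_def)
    then have dev: "real n * (\<integral>x. b y x \<partial>P) - \<beta> * real n \<le> (\<Sum>i=1..n. b y (X i w))"
      using w unfolding Bb_def by auto
    have "(\<integral>x. b y x \<partial>P) = measure P (cball (\<theta>0 + y) e)"
      using sets_P sets_eq_imp_space_eq[OF sets_P] by (simp add: b_eq)
    then have "real n * (2 * \<beta>) \<le> real n * (\<integral>x. b y x \<partial>P)"
      using balls[OF y] by (intro mult_left_mono) auto
    then show "\<beta> * real n \<le> (\<Sum>i=1..n. indicator (cball y e) (X i w - \<theta>0))"
      using dev by (simp add: b_def algebra_simps)
  qed
qed

theorem theorem1:
  fixes r q \<omega> :: real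
    and u \<theta>s :: "real ^ 'n"
    and P Q :: "(real ^ 'n) measure"
    and p \<pi> :: "real ^ 'n \<Rightarrow> real"
    and K :: "(real ^ 'n) set"
    and M :: "'w measure"
    and X :: "nat \<Rightarrow> 'w \<Rightarrow> real ^ 'n"
    and a :: "nat \<Rightarrow> real"
  assumes "CARD('n) \<ge> 2"
    and "1 < r" and "1 / r + 1 / q = 1"
    and "lr_norm q u < 1"
    and "prob_space M"
    and "prob_space P" and "prob_space Q"
    and "prob_space.indep_vars M (\<lambda>_. borel) X {1..}"
    and "\<forall>i\<ge>1. distr M borel (X i) = P"
    and "is_geometric_quantile r u P \<theta>s"
    and "has_lebesgue_density P p"
    and "compact K" and "\<theta>s \<in> K" and "interior K \<noteq> {}"
    and "continuous_on K p" and "bounded_away_from_0_on K p"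
    and "\<forall>C. compact C \<longrightarrow> bounded (p ` C)"
    and "has_lebesgue_density Q \<pi>"
    and "\<exists>U. open U \<and> \<theta>s \<in> U \<and> continuous_on U \<pi> \<and> bounded_away_from_0_on U \<pi>"
    and "\<omega> > 0"
    and "filterlim a at_top sequentially"
  shows "(\<lambda>n. \<integral>x. measure (gibbs_posterior r u \<omega> Q n x)
                  {\<theta>. norm (\<theta> - \<theta>s) > a n * real n powr (- 1 / 2)} \<partial>joint_law M X n)
           \<longlonglongrightarrow> 0"
proof -
  note d2 = assms(1) and r = assms(2-4) and M = assms(5) and P = assms(6) and Q = assms(7)
    and X = assms(8) and XP = assms(9) and quantile = assms(10) and p = assms(11)
    and \<pi> = assms(18) and \<omega> = assms(20) and a = assms(21)
  interpret M: prob_space M by fact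
  interpret Q: prob_space Q by fact
  let ?d = "CARD('n)"
  have sets_P: "sets P = sets borel" and sets_Q: "sets Q = sets borel"
    using p \<pi> by (auto simp: has_lebesgue_density_def)
  have X_meas: "X i \<in> borel_measurable M" if "1 \<le> i" for i
    using X that unfolding M.indep_vars_def by auto

  \<comment> \<open>Two balls of positive mass and the centred gradient\<close>
  define W where "W = (\<lambda>x. x - \<theta>s) ` interior K"
  have W: "open W" "W \<noteq> {}"
    using assms(14) by (auto simp: W_def intro: open_translation_subtract)
  obtain y1 y2 e cg where e: "0 < e" and cg: "0 < cg" and y: "cball y1 e \<subseteq> W" "cball y2 e \<subseteq> W"
    and growth: "\<And>d. norm d \<le> e \<Longrightarrow> \<exists>y\<in>{y1, y2}. \<forall>t\<in>cball y e.
       lr_norm r t + lr_grad r t \<bullet> d + cg * (norm d)\<^sup>2 \<le> lr_norm r (t + d)"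
    by (rule obtain_growth_balls[OF d2 W r(1)]) (rule that)
  obtain cp where cp: "0 < cp" "\<And>x. x \<in> K \<Longrightarrow> cp \<le> p x"
    using assms(16) by (auto simp: bounded_away_from_0_on_def)
  have ball_pos: "0 < measure P (cball (\<theta>s + y) e)" if "y \<in> {y1, y2}" for y
  proof (rule measure_density_cball_pos[OF P p cp(1) _ e])
    fix x assume "x \<in> cball (\<theta>s + y) e"
    then have "x - \<theta>s \<in> cball y e" by (simp add: dist_norm algebra_simps)
    then have "x - \<theta>s \<in> W" using that y by auto
    then have "x \<in> K" using interior_subset[of K] by (auto simp: W_def)
    then show "cp \<le> p x" by (rule cp)
  qed
  \<comment> \<open>Half of the smaller ball mass: the expected count is at least
    \<open>2 * \<beta> * n\<close>, and a fluctuation below \<open>\<beta> * n\<close> leaves the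
    required \<open>\<beta> * n\<close>.\<close>
  define \<beta> where "\<beta> = min (measure P (cball (\<theta>s + y1) e)) (measure P (cball (\<theta>s + y2) e)) / 2"
  have \<beta>: "0 < \<beta>" using ball_pos by (simp add: \<beta>_def)
  have balls: "2 * \<beta> \<le> measure P (cball (\<theta>s + y) e)" if "y \<in> {y1, y2}" for y
    using that by (auto simp: \<beta>_def)
  have mean: "(\<integral>x. (lr_grad r (x - \<theta>s) + u) $ j \<partial>P) = 0" for j
    by (rule geometric_quantile_mean_gradient_eq_0[OF r(1) P sets_P AE_density_components_neq[OF p] quantile])

  \<comment> \<open>Local bounds on the prior density and the choice of scales\<close>
  obtain U where U: "open U" "\<theta>s \<in> U" "continuous_on U \<pi>" "bounded_away_from_0_on U \<pi>"
    using assms(19) by blast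
  obtain \<rho> where \<rho>: "0 < \<rho>" "cball \<theta>s \<rho> \<subseteq> U" using U open_contains_cball by blast
  obtain c where c: "0 < c" "\<And>\<theta>. \<theta> \<in> cball \<theta>s \<rho> \<Longrightarrow> c \<le> \<pi> \<theta>"
    using U(4) \<rho>(2) unfolding bounded_away_from_0_on_def by (meson subsetD)
  have "bounded (\<pi> ` cball \<theta>s \<rho>)"
    using U(3) \<rho>(2) by (intro compact_imp_bounded compact_continuous_image continuous_on_subset[OF U(3)]) auto
  then obtain C where C: "\<And>\<theta>. \<theta> \<in> cball \<theta>s \<rho> \<Longrightarrow> \<pi> \<theta> \<le> C"
    unfolding bounded_iff by (metis abs_le_D1 imageI real_norm_def)

  define \<Lambda> where "\<Lambda> = \<omega> * (?d + norm u)"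
  have \<Lambda>: "0 < \<Lambda>" using \<omega> by (simp add: \<Lambda>_def add_pos_nonneg)
  \<comment> \<open>Chosen so that \<open>\<omega>\<close> times the excess is at most 1 on the ball
    of radius \<open>\<eta> / n\<close>, which lies inside the ball of radius
    \<open>\<rho>\<close>.\<close>
  define \<eta> where "\<eta> = min \<rho> (1 / \<Lambda>)"
  have \<eta>: "0 < \<eta>" "\<eta> \<le> \<rho>" "\<Lambda> * \<eta> \<le> 1" using \<rho> \<Lambda> by (auto simp: \<eta>_def min_def field_simps)
  \<comment> \<open>Capping \<open>a\<close> makes the tail set start within distance
    \<open>\<rho>\<close> of the quantile. It only enlarges that set, and \<open>a'\<close> still
    diverges, however fast \<open>a\<close> grows.\<close>
  define a' where "a' = (\<lambda>n. min (a n) (sqrt n * \<rho>))"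
  have a': "filterlim a' at_top sequentially"
  proof -
    have "filterlim (\<lambda>n. \<rho> * sqrt (real n)) at_top sequentially"
      using \<rho> by (intro filterlim_tendsto_pos_mult_at_top[OF tendsto_const] filterlim_compose[OF sqrt_at_top filterlim_real_sequentially])
    with a show ?thesis
      unfolding filterlim_at_top a'_def by (auto simp: eventually_conj_iff mult.commute)
  qed
  define T where "T = (\<lambda>(a :: nat \<Rightarrow> real) n. {\<theta>. norm (\<theta> - \<theta>s) > a n * real n powr (- 1 / 2)})"
  define f where "f = (\<lambda>n x. measure (gibbs_posterior r u \<omega> Q n x) (T a n))"
  have f_le_1: "f n x \<le> 1" for n x
    unfolding f_def
    by (intro prob_space.prob_le_1 prob_space_gibbs_posterior Q sets_Q gibbs_weight_integrable[OF r \<omega>])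
  have f_le: "f n x \<le> measure (gibbs_posterior r u \<omega> Q n x) (T a' n)" for n x
  proof -
    interpret G: prob_space "gibbs_posterior r u \<omega> Q n x"
      by (intro prob_space_gibbs_posterior Q sets_Q gibbs_weight_integrable[OF r \<omega>])
    have "a' n * real n powr (- 1 / 2) \<le> a n * real n powr (- 1 / 2)"
      by (intro mult_right_mono) (auto simp: a'_def)
    then have "T a n \<subseteq> T a' n" by (auto simp: T_def)
    moreover have "T a' n \<in> sets borel" unfolding T_def by measurable
    then have "T a' n \<in> G.events" using sets_Q by (simp add: gibbs_posterior_def)
    ultimately show ?thesis unfolding f_def by (rule G.finite_measure_mono)
  qed
  define \<kappa> where "\<kappa> = (\<lambda>n. C / c * 2 ^ ?d * exp (- (\<omega> * a' n) / 2)
      + exp (1 - \<omega> * (sqrt n * \<rho>)) / (c * measure lborel (cball \<theta>s (\<eta> / real n))))"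
  have \<kappa>: "\<kappa> \<longlonglongrightarrow> 0"
    unfolding \<kappa>_def by (rule posterior_bound_tendsto_0[OF a' \<omega> \<rho>(1) c(1) \<eta>(1)])

  \<comment> \<open>The expected posterior mass of the tail is eventually below any positive
    bound\<close>
  have "\<forall>\<^sub>F n in sequentially. (\<integral>x. f n x \<partial>joint_law M X n) < \<epsilon>" if \<epsilon>: "0 < \<epsilon>" for \<epsilon> :: real
  proof -
    \<comment> \<open>The order of choices matters: \<open>k\<close> depends on
      \<open>\<epsilon>\<close> alone, \<open>L\<close> on \<open>k\<close>, and only then is
      \<open>n\<close> taken large.\<close>
    have "((\<lambda>k. 2 * ?d * exp (- k\<^sup>2 / (2 * (1 + norm u)\<^sup>2))) \<longlongrightarrow> 0) at_top"
    proof -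
      have "0 < 1 + norm u" by (simp add: add_pos_nonneg)
      then have "0 < 2 * (1 + norm u)\<^sup>2" by simp
      then show ?thesis by real_asymp
    qed
    then have "\<forall>\<^sub>F k in at_top. 2 * ?d * exp (- k\<^sup>2 / (2 * (1 + norm u)\<^sup>2)) < \<epsilon> / 3"
      using \<epsilon> by (intro order_tendstoD) auto
    then have "\<forall>\<^sub>F k in at_top. 0 \<le> k \<and> 2 * ?d * exp (- k\<^sup>2 / (2 * (1 + norm u)\<^sup>2)) < \<epsilon> / 3"
      using eventually_ge_at_top by (rule eventually_conj[rotated])
    then obtain k where k: "0 \<le> k" "2 * ?d * exp (- k\<^sup>2 / (2 * (1 + norm u)\<^sup>2)) < \<epsilon> / 3"
      by (auto simp: eventually_at_top_linorder)
    define L where "L = (?d * k + 1) / (cg * \<beta>)"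
    have L: "0 < L" "?d * k + 1 \<le> cg * \<beta> * L"
      using cg \<beta> k by (auto simp: L_def intro!: divide_pos_pos add_nonneg_pos)
    have "(\<lambda>n. 4 * exp (- (\<beta>\<^sup>2 / 2) * real n)) \<longlonglongrightarrow> 0"
      using \<beta> by real_asymp
    then have "\<forall>\<^sub>F n in sequentially. 4 * exp (- (\<beta>\<^sup>2 / 2) * real n) < \<epsilon> / 3"
      by (rule order_tendstoD(2)) (use \<epsilon> in simp)
    moreover have "\<forall>\<^sub>F n in sequentially. \<kappa> n < \<epsilon> / 3"
      using \<epsilon> \<kappa> by (intro order_tendstoD) auto
    moreover have "\<forall>\<^sub>F n in sequentially. L \<le> a' n"
      using a' by (simp add: filterlim_at_top)
    moreover have "\<forall>\<^sub>F n in sequentially. L \<le> e * sqrt (real n)"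
    proof -
      have "filterlim (\<lambda>n. e * sqrt (real n)) at_top sequentially"
        using e by (intro filterlim_tendsto_pos_mult_at_top[OF tendsto_const] filterlim_compose[OF sqrt_at_top filterlim_real_sequentially])
      then show ?thesis by (simp add: filterlim_at_top)
    qed
    ultimately show ?thesis
      using eventually_ge_at_top[of "1 :: nat"]
    proof eventually_elim
      fix n :: nat
      assume n: "4 * exp (- (\<beta>\<^sup>2 / 2) * real n) < \<epsilon> / 3" "\<kappa> n < \<epsilon> / 3" "L \<le> a' n" "L \<le> e * sqrt (real n)" "1 \<le> n"
      obtain B where B: "B \<in> sets M"
        "measure M B \<le> 2 * ?d * exp (- k\<^sup>2 / (2 * (1 + norm u)\<^sup>2)) + 4 * exp (- (\<beta>\<^sup>2 / 2) * real n)"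
        "\<And>w j. w \<in> space M - B \<Longrightarrow> \<bar>\<Sum>i=1..n. (lr_grad r (X i w - \<theta>s) + u) $ j\<bar> \<le> k * sqrt n"
        "\<And>w y. w \<in> space M - B \<Longrightarrow> y \<in> {y1, y2} \<Longrightarrow> \<beta> * real n \<le> (\<Sum>i=1..n. indicator (cball y e) (X i w - \<theta>s))"
        by (rule bad_event_probability_le[OF M X XP r(1) sets_P mean balls k(1) less_imp_le[OF \<beta>] n(5)]) (assumption, rule that)
      have good: "f n (\<lambda>i\<in>{1..n}. X i w) \<le> \<kappa> n" if w: "w \<in> space M - B" for w
      proof -
        let ?x = "\<lambda>i\<in>{1..n}. X i w"
        have "measure (gibbs_posterior r u \<omega> Q n ?x) (T a' n) \<le> \<kappa> n"
          unfolding T_def \<kappa>_def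
        proof (rule gibbs_posterior_tail_le[OF r \<omega> n(5) \<pi> Q c(2) C c(1)])
          show "0 < \<eta> / real n" using \<eta> n by simp
          have "\<eta> / real n \<le> \<eta> / 1" using \<eta> n by (intro divide_left_mono) auto
          then show "\<eta> / real n \<le> \<rho>" using \<eta> by simp
          show "\<omega> * (real n * ((?d + norm u) * (\<eta> / real n))) \<le> 1"
            using \<eta>(3) n by (simp add: \<Lambda>_def)
          show "0 \<le> a' n" using n L by simp
          show "a' n \<le> sqrt n * \<rho>" by (simp add: a'_def)
          fix \<theta> assume "a' n \<le> sqrt n * norm (\<theta> - \<theta>s)"
          \<comment> \<open>\<open>L\<close> is fixed while \<open>a'\<close> diverges, so beyond
            \<open>a' n\<close> the linear growth is already in force.\<close>
          then have "L \<le> sqrt n * norm (\<theta> - \<theta>s)" using n by simp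
          then show "sqrt n * norm (\<theta> - \<theta>s) \<le> excess r u \<theta>s n ?x \<theta>"
            using B(3,4)[OF w] by (intro excess_linear_growth[OF r(1) e cg growth _ _ L n(5,4)]) auto
        qed
        then show ?thesis using f_le[of n ?x] by simp
      qed
      have "0 \<le> \<kappa> n"
      proof -
        have "0 \<le> C" using c(2)[of \<theta>s] C[of \<theta>s] c(1) \<rho>(1) by simp
        then show ?thesis using c(1) by (simp add: \<kappa>_def)
      qed
      then have "(\<integral>x. f n x \<partial>joint_law M X n) \<le> measure M B + \<kappa> n"
        using X_meas f_le_1 good by (intro integral_joint_law_le M B(1))
      then show "(\<integral>x. f n x \<partial>joint_law M X n) < \<epsilon>"
        using B(2) k(2) n(1,2) by simp
    qed
  qed
  moreover have "0 \<le> (\<integral>x. f n x \<partial>joint_law M X n)" for n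
    by (rule Bochner_Integration.integral_nonneg) (simp add: f_def)
  ultimately have "(\<lambda>n. \<integral>x. f n x \<partial>joint_law M X n) \<longlonglongrightarrow> 0"
    by (intro order_tendstoI) (auto intro: always_eventually less_le_trans)
  then show ?thesis by (simp add: f_def T_def)
qed

end
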